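(* Let $m_3',\infty_4',\infty_5',o_3',o_4',\alpha_3',\beta_4',\beta_5'$ be the real matrices (Lee–Weinberg blocks) defined in the context, depending on an integer $k$ and, where indicated, on $\varepsilon\in\{1,-1\}$, on a real $\alpha>0$, or on nonzero reals $a,b$. Then the following real-congruences hold: 1. $m_3'$ is real-congruent to $J_{2k+1}(0)$. 2. $\infty_4'$ ($k$ even) is real-congruent to $\Gamma_k\otimes\left(\varepsilon(-1)^{\frac k2+1}\right)$. 3. $\infty_5'$ ($k$ odd) is real-congruent to $\Gamma_k\otimes C(0,1)$. 4. $o_3'$ ($k$ odd) is real-congruent to $\Gamma_k\otimes\left(\varepsilon(-1)^{\frac{k-1}2}\right)$. 5. $o_4'$ ($k$ even) is real-congruent to $\Gamma_k\otimes C(0,1)$. 6. $\alpha_3'$ is real-congruent to $J_{2k}(0)$ if $\alpha=1$, and to $H_{2k}\left(\frac{1-\alpha}{1+\alpha}\right)$ if $\alpha\ne1$. 7. $\beta_4'$ is real-congruent, for some choice of the sign $\pm$, to $\Gamma_k\otimes C\left(\pm\frac{|b|}{\sqrt{1+b^2}},\frac1{\sqrt{1+b^2}}\right)$ if $k$ is even, and to $\Gamma_k\otimes C\left(\pm\frac1{\sqrt{1+b^2}},\frac{|b|}{\sqrt{1+b^2}}\right)$ if $k$ is odd. 8. $\beta_5'$ is real-congruent to $\widehat H_{4k}\left(\frac{1-(a^2+b^2)}{(1+|a|)^2+b^2},\frac{2|b|}{(1+|a|)^2+b^2}\right)$.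
   Context: Two matrices $A,B\in\mathbb{R}^{n\times n}$ are real-congruent if there is an invertible $S\in\mathbb{R}^{n\times n}$ with $SAS^\top=B$. $\otimes$ is the Kronecker product. Target blocks ($k\ge1$): $J_k(\mu)$ is the $k\times k$ upper triangular Jordan block with $\mu$ on the diagonal and $1$ on the superdiagonal. $\Gamma_k$ is the $k\times k$ matrix whose only nonzero entries are $(\Gamma_k)_{r,\,k+1-r}=(-1)^{k-r}$ for $1\le r\le k$ and $(\Gamma_k)_{r,\,k+2-r}=(-1)^{k-r}$ for $2\le r\le k$; so $\Gamma_1=1$, $\Gamma_2=\begin{bmatrix} 0 & -1 \\ 1 & 1 \end{bmatrix}$. $H_{2k}(\mu)=\begin{bmatrix} 0 & I_k \\ J_k(\mu) & 0 \end{bmatrix}$. $C(a,b)=\begin{bmatrix} a & b \\ -b & a \end{bmatrix}$; $C_{2k}(a,b)$ is the $2k\times 2k$ block upper bidiagonal matrix with $k$ diagonal blocks equal to $C(a,b)$, blocks $I_2$ on the block superdiagonal and zeros elsewhere; $\widehat H_{4k}(a,b)=\begin{bmatrix} 0 & I_{2k} \\ C_{2k}(a,b) & 0 \end{bmatrix}$. Auxiliary matrices: $L_k$ is the $(k+1)\times k$ matrix with entries $1$ in positions $(i,i)$ and $(i+1,i)$, $1\le i\le k$, zeros elsewhere. $L_k^+$ is the $k\times(k+1)$ matrix with entries $1$ in positions $(i,i)$ and $-1$ in positions $(i,i+1)$, $1\le i\le k$, zeros elsewhere. $\Delta_k$ is the $k\times k$ matrix with ones in positions $(i,j)$ with $i+j=k+1$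 and zeros elsewhere. $\Lambda_k$ is the $k\times k$ matrix with ones in positions $(i,j)$ with $i+j=k+2$ and zeros elsewhere ($\Lambda_1=0$). $S\Delta_k$ is the $k\times k$ matrix $\begin{bmatrix} 0 & \Delta_{k/2} \\ -\Delta_{k/2} & 0 \end{bmatrix}$ if $k$ is even, and $\begin{bmatrix} 0 & 0 & 0 \\ 0 & 0 & \Delta_{(k-1)/2} \\ 0 & -\Delta_{(k-1)/2} & 0 \end{bmatrix}$ (with first diagonal block $1\times1$) if $k$ is odd. Lee–Weinberg blocks: $m_3'=\begin{bmatrix} 0 & L_k \\ L_k^+ & 0 \end{bmatrix}$ of size $(2k+1)\times(2k+1)$, $k\ge0$ ($m_3'=0$, of size $1\times1$, if $k=0$); $\infty_4'=\varepsilon(S\Delta_k+\Lambda_k)$, $\varepsilon=\pm1$, $k$ even; $\infty_5'=\begin{bmatrix} 0 & \Delta_k+\Lambda_k \\ -\Delta_k+\Lambda_k & 0 \end{bmatrix}$, $k$ odd; $o_3'=\varepsilon(\Delta_k+S\Delta_k)$, $\varepsilon=\pm1$, $k$ odd; $o_4'=\begin{bmatrix} 0 & \Delta_k+\Lambda_k \\ \Delta_k-\Lambda_k & 0 \end{bmatrix}$, $k$ even; $\alpha_3'=\begin{bmatrix} 0 & (\alpha+1)\Delta_k+\Lambda_k \\ (-\alpha+1)\Delta_k-\Lambda_k & 0 \end{bmatrix}$, $\alpha\in\mathbb{R}$, $\alpha>0$; $\beta_4'=\varepsilon M$, $\varepsilon=\pm1$, where $M$ is the $2k\times2k$ matrix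 of $k\times k$ blocks of size $2\times2$ whose $(i,j)$ block is $R$ if $i+j=k+1$, $S$ if $i+j=k+2$, and $0$ otherwise; $\beta_5'=\begin{bmatrix} 0 & X \\ Y & 0 \end{bmatrix}$ of size $4k\times4k$, where $X$, $Y$ are $2k\times2k$ matrices of $k\times k$ blocks of size $2\times2$: the $(i,j)$ block of $X$ is $R'$ if $i+j=k+1$, $S'$ if $i+j=k+2$, $0$ otherwise; the $(i,j)$ block of $Y$ is $-T$ if $i+j=k+1$, $-S'$ if $i+j=k+2$, $0$ otherwise. Here $k\ge1$ except in $m_3'$, and $R=\begin{bmatrix} 1 & |b| \\ -|b| & 1 \end{bmatrix}$, $S=\begin{bmatrix} 0 & 1 \\ -1 & 0 \end{bmatrix}$, $T=\begin{bmatrix} b & a-1 \\ a-1 & -b \end{bmatrix}$, $R'=\begin{bmatrix} b & a+1 \\ a+1 & -b \end{bmatrix}$, $S'=\begin{bmatrix} 0 & 1 \\ 1 & 0 \end{bmatrix}$, with $a,b\in\mathbb{R}$, $a\ne0$, $b\ne0$. *)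

theory Defs
  imports Complex_Main "Jordan_Normal_Form.Jordan_Normal_Form"
begin

definition real_congruent :: "real mat \<Rightarrow> real mat \<Rightarrow> bool" where
  "real_congruent A B \<longleftrightarrow>
     (\<exists>n. A \<in> carrier_mat n n \<and> B \<in> carrier_mat n n \<and>
        (\<exists>S \<in> carrier_mat n n. invertible_mat S \<and> S * A * transpose_mat S = B))"

(* The entry function of mat1, and the block function of block_mat1, receive 1-based positions;
   entries of the resulting matrix are still accessed with 0-based indices. *)
definition mat1 :: "nat \<Rightarrow> nat \<Rightarrow> (nat \<Rightarrow> nat \<Rightarrow> real) \<Rightarrow> real mat" where
  "mat1 m n f = mat m n (\<lambda>(i, j). f (i + 1) (j + 1))"

(* k x k blocks, each of size 2 x 2. *)
definition block_mat1 :: "nat \<Rightarrow> (nat \<Rightarrow> nat \<Rightarrow> real mat) \<Rightarrow> real mat" where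
  "block_mat1 k F =
     mat (2 * k) (2 * k) (\<lambda>(i, j). F (i div 2 + 1) (j div 2 + 1) $$ (i mod 2, j mod 2))"

definition mat_2x2 :: "real \<Rightarrow> real \<Rightarrow> real \<Rightarrow> real \<Rightarrow> real mat" where
  "mat_2x2 p q r s = mat_of_rows_list 2 [[p, q], [r, s]]"

definition mat_1x1 :: "real \<Rightarrow> real mat" where
  "mat_1x1 c = mat_of_rows_list 1 [[c]]"

definition kronecker :: "real mat \<Rightarrow> real mat \<Rightarrow> real mat"  (infixl "\<otimes>\<^sub>K" 70) where
  "A \<otimes>\<^sub>K B = mat (dim_row A * dim_row B) (dim_col A * dim_col B)
     (\<lambda>(i, j). A $$ (i div dim_row B, j div dim_col B) * B $$ (i mod dim_row B, j mod dim_col B))"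

definition Gamma_mat :: "nat \<Rightarrow> real mat" where
  "Gamma_mat k = mat1 k k (\<lambda>r c. if r + c = k + 1 \<or> r + c = k + 2 then (-1) ^ (k - r) else 0)"

(* H_mat k is the 2k x 2k matrix H_{2k}; likewise C_blocks k is C_{2k} and H_hat k is the
   4k x 4k matrix H-hat_{4k}. *)
definition H_mat :: "nat \<Rightarrow> real \<Rightarrow> real mat" where
  "H_mat k \<mu> = four_block_mat (0\<^sub>m k k) (1\<^sub>m k) (jordan_block k \<mu>) (0\<^sub>m k k)"

definition C_mat :: "real \<Rightarrow> real \<Rightarrow> real mat" where
  "C_mat a b = mat_2x2 a b (-b) a"

definition C_blocks :: "nat \<Rightarrow> real \<Rightarrow> real \<Rightarrow> real mat" where
  "C_blocks k a b = block_mat1 k (\<lambda>i j.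
     if i = j then C_mat a b else if j = i + 1 then 1\<^sub>m 2 else 0\<^sub>m 2 2)"

definition H_hat :: "nat \<Rightarrow> real \<Rightarrow> real \<Rightarrow> real mat" where
  "H_hat k a b =
     four_block_mat (0\<^sub>m (2 * k) (2 * k)) (1\<^sub>m (2 * k)) (C_blocks k a b) (0\<^sub>m (2 * k) (2 * k))"

definition L_mat :: "nat \<Rightarrow> real mat" where
  "L_mat k = mat1 (k + 1) k (\<lambda>i j. if i = j \<or> i = j + 1 then 1 else 0)"

definition L_plus :: "nat \<Rightarrow> real mat" where
  "L_plus k = mat1 k (k + 1) (\<lambda>i j. if j = i then 1 else if j = i + 1 then -1 else 0)"

definition Delta_mat :: "nat \<Rightarrow> real mat" where
  "Delta_mat k = mat1 k k (\<lambda>i j. if i + j = k + 1 then 1 else 0)"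

definition Lambda_mat :: "nat \<Rightarrow> real mat" where
  "Lambda_mat k = mat1 k k (\<lambda>i j. if i + j = k + 2 then 1 else 0)"

definition skew_Delta :: "nat \<Rightarrow> real mat" where
  "skew_Delta l = four_block_mat (0\<^sub>m l l) (Delta_mat l) (- Delta_mat l) (0\<^sub>m l l)"

definition S_Delta :: "nat \<Rightarrow> real mat" where
  "S_Delta k =
     (if even k then skew_Delta (k div 2)
      else four_block_mat (0\<^sub>m 1 1) (0\<^sub>m 1 (k - 1)) (0\<^sub>m (k - 1) 1) (skew_Delta ((k - 1) div 2)))"

definition lw_m3 :: "nat \<Rightarrow> real mat" where
  "lw_m3 k = four_block_mat (0\<^sub>m (k + 1) (k + 1)) (L_mat k) (L_plus k) (0\<^sub>m k k)"

definition lw_inf4 :: "real \<Rightarrow> nat \<Rightarrow> real mat" where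
  "lw_inf4 \<epsilon> k = \<epsilon> \<cdot>\<^sub>m (S_Delta k + Lambda_mat k)"

definition lw_inf5 :: "nat \<Rightarrow> real mat" where
  "lw_inf5 k = four_block_mat (0\<^sub>m k k) (Delta_mat k + Lambda_mat k)
     (- Delta_mat k + Lambda_mat k) (0\<^sub>m k k)"

definition lw_o3 :: "real \<Rightarrow> nat \<Rightarrow> real mat" where
  "lw_o3 \<epsilon> k = \<epsilon> \<cdot>\<^sub>m (Delta_mat k + S_Delta k)"

definition lw_o4 :: "nat \<Rightarrow> real mat" where
  "lw_o4 k = four_block_mat (0\<^sub>m k k) (Delta_mat k + Lambda_mat k)
     (Delta_mat k - Lambda_mat k) (0\<^sub>m k k)"

definition lw_alpha3 :: "real \<Rightarrow> nat \<Rightarrow> real mat" where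
  "lw_alpha3 \<alpha> k = four_block_mat (0\<^sub>m k k) ((\<alpha> + 1) \<cdot>\<^sub>m Delta_mat k + Lambda_mat k)
     ((- \<alpha> + 1) \<cdot>\<^sub>m Delta_mat k - Lambda_mat k) (0\<^sub>m k k)"

(* 2 x 2 blocks P where i + j = k + 1 and Q where i + j = k + 2. *)
definition anti_blocks :: "nat \<Rightarrow> real mat \<Rightarrow> real mat \<Rightarrow> real mat" where
  "anti_blocks k P Q = block_mat1 k (\<lambda>i j.
     if i + j = k + 1 then P else if i + j = k + 2 then Q else 0\<^sub>m 2 2)"

definition lw_beta4 :: "real \<Rightarrow> real \<Rightarrow> nat \<Rightarrow> real mat" where
  "lw_beta4 \<epsilon> b k = \<epsilon> \<cdot>\<^sub>m anti_blocks k (mat_2x2 1 \<bar>b\<bar> (- \<bar>b\<bar>) 1) (mat_2x2 0 1 (-1) 0)"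

definition lw_beta5 :: "real \<Rightarrow> real \<Rightarrow> nat \<Rightarrow> real mat" where
  "lw_beta5 a b k =
     (let R' = mat_2x2 b (a + 1) (a + 1) (-b);
          T = mat_2x2 b (a - 1) (a - 1) (-b);
          S' = mat_2x2 0 1 1 0
      in four_block_mat (0\<^sub>m (2 * k) (2 * k)) (anti_blocks k R' S')
           (anti_blocks k (- T) (- S')) (0\<^sub>m (2 * k) (2 * k)))"

end

theory Submission
  imports Defs "HOL-Computational_Algebra.Formal_Power_Series"
begin

text \<open>The matrices \<open>\<Delta>\<close> and \<open>\<Lambda> = \<Delta> N\<close> (\<open>N\<close> the nilpotent shift) are Hankel matrices: \<open>\<Delta> f(N)\<close> is the Gram
  matrix of the form \<open>(u, v) \<mapsto> [x\<^bsup>k-1\<^esup>] u f v\<close> on truncated power series. A congruence is therefore a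
  change of basis of \<open>F[x] / x\<^bsup>k\<^esup>\<close>. Given two such forms with symbols \<open>f\<close> and \<open>g\<close>, the powers of the local
  parameter \<open>\<tau> = g / f - \<mu>\<close>, rescaled so as to be dual to each other under the residue pairing, bring
  the pencil to Jordan form. This settles \<open>\<alpha>\<^sub>3'\<close> over the reals and \<open>\<beta>\<^sub>5'\<close> over the complex numbers. For
  \<open>\<beta>\<^sub>4'\<close> both sides must be rescaled by the same series, hence by a square root. Complex matrices return to
  real ones through \<open>p + \<i> q \<mapsto> C(p, q)\<close>, under which the adjoint becomes the transpose. The
  blocks \<open>\<infinity>\<^sub>4'\<close>, \<open>\<infinity>\<^sub>5'\<close>, \<open>o\<^sub>3'\<close>, \<open>o\<^sub>4'\<close> only need a signed permutation, and \<open>m\<^sub>3'\<close> is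
  reduced by the Moebius substitution that takes \<open>1 + x\<close> and \<open>1 - x\<close> to multiples of \<open>1\<close> and \<open>x\<close>.\<close>

subsection \<open>Real congruence\<close>

lemma index_mult_mat_sum:
  assumes "A \<in> carrier_mat n m" "B \<in> carrier_mat m p" "i < n" "j < p"
  shows "(A * B) $$ (i, j) = (\<Sum>l<m. A $$ (i, l) * B $$ (l, j))"
  using assms by (auto simp: scalar_prod_def lessThan_atLeast0 intro!: sum.cong)

lemma invertible_matI:
  fixes A B :: "'a::field mat"
  assumes "A \<in> carrier_mat n n" "B \<in> carrier_mat n n" "A * B = 1\<^sub>m n"
  shows "invertible_mat A"
  using assms mat_mult_left_right_inverse[OF assms]
  unfolding invertible_mat_def inverts_mat_def by auto

lemma invertible_matE:
  assumes "invertible_mat A" "A \<in> carrier_mat n n"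
  obtains B where "B \<in> carrier_mat n n" "A * B = 1\<^sub>m n" "B * A = 1\<^sub>m n"
proof -
  from assms obtain B where AB: "A * B = 1\<^sub>m n" "B * A = 1\<^sub>m (dim_row B)"
    unfolding invertible_mat_def inverts_mat_def by auto
  have "dim_row B = n" using arg_cong[OF AB(2), of dim_col] assms by simp
  moreover have "dim_col B = n" using arg_cong[OF AB(1), of dim_col] by simp
  ultimately show ?thesis using AB that by auto
qed

lemma invertible_mat_mult:
  fixes A B :: "'a::field mat"
  assumes "A \<in> carrier_mat n n" "B \<in> carrier_mat n n" "invertible_mat A" "invertible_mat B"
  shows "invertible_mat (A * B)"
proof -
  obtain A' where A': "A' \<in> carrier_mat n n" "A * A' = 1\<^sub>m n"
    using invertible_matE[OF assms(3,1)] .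
  obtain B' where B': "B' \<in> carrier_mat n n" "B * B' = 1\<^sub>m n"
    using invertible_matE[OF assms(4,2)] .
  have "A * B * (B' * A') = A * (B * B') * A'"
    using assms(1,2) A'(1) B'(1) by (simp add: assoc_mult_mat[of _ n n _ n _ n])
  also have "\<dots> = 1\<^sub>m n" using assms A' B' by simp
  finally show ?thesis
    using assms A' B' by (intro invertible_matI[of _ n "B' * A'"]) auto
qed

lemma real_congruentI:
  assumes "A \<in> carrier_mat n n" "S \<in> carrier_mat n n" "invertible_mat S"
    "S * A * transpose_mat S = B"
  shows "real_congruent A B"
  unfolding real_congruent_def using assms by (intro exI[of _ n]) auto

lemma real_congruent_trans:
  assumes "real_congruent A B" "real_congruent B C"
  shows "real_congruent A C"
proof -
  obtain n S where S: "A \<in> carrier_mat n n" "B \<in> carrier_mat n n" "S \<in> carrier_mat n n"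
    "invertible_mat S" "S * A * transpose_mat S = B"
    using assms(1) unfolding real_congruent_def by auto
  obtain m U where U: "B \<in> carrier_mat m m" "U \<in> carrier_mat m m"
    "invertible_mat U" "U * B * transpose_mat U = C"
    using assms(2) unfolding real_congruent_def by auto
  have [simp]: "m = n" using S(2) U(1) by auto
  have "(U * S) * A * transpose_mat (U * S) = U * (S * A * transpose_mat S) * transpose_mat U"
    using S(1,3) U(2) by (simp add: transpose_mult[of _ n n _ n] assoc_mult_mat[of _ n n _ n _ n])
  then show ?thesis
    using S U by (intro real_congruentI[of A n "U * S"]) (auto intro: invertible_mat_mult[of _ n])
qed

text \<open>The congruence is by a monomial matrix: row \<open>i\<close> of \<open>S\<close> has the
  single nonzero entry \<open>d i\<close>, in column \<open>\<pi> i\<close>.\<close>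

lemma real_congruent_monomial:
  fixes d :: "nat \<Rightarrow> real"
  assumes A: "A \<in> carrier_mat n n" and B: "B \<in> carrier_mat n n"
    and \<pi>: "\<And>i. i < n \<Longrightarrow> \<pi> i < n" "inj_on \<pi> {..<n}"
    and d: "\<And>i. i < n \<Longrightarrow> d i \<noteq> 0"
    and AB: "\<And>i j. i < n \<Longrightarrow> j < n \<Longrightarrow> B $$ (i, j) = d i * d j * A $$ (\<pi> i, \<pi> j)"
  shows "real_congruent A B"
proof (rule real_congruentI)
  define S where "S = mat n n (\<lambda>(i, j). if j = \<pi> i then d i else 0)"
  define S' where "S' = mat n n (\<lambda>(i, j). if i = \<pi> j then 1 / d j else 0)"
  have S: "S \<in> carrier_mat n n" and S': "S' \<in> carrier_mat n n" by (auto simp: S_def S'_def)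
  show "A \<in> carrier_mat n n" "S \<in> carrier_mat n n" by fact+
  have SM: "(S * M) $$ (i, j) = d i * M $$ (\<pi> i, j)"
    if "M \<in> carrier_mat n n" "i < n" "j < n" for M i j
  proof -
    have "(S * M) $$ (i, j) = (\<Sum>l<n. S $$ (i, l) * M $$ (l, j))"
      using S that by (rule index_mult_mat_sum)
    also have "\<dots> = (\<Sum>l<n. if l = \<pi> i then d i * M $$ (l, j) else 0)"
      using that by (intro sum.cong) (auto simp: S_def)
    also have "\<dots> = d i * M $$ (\<pi> i, j)" using that \<pi>(1) by simp
    finally show ?thesis .
  qed
  have MS: "(M * transpose_mat S) $$ (i, j) = d j * M $$ (i, \<pi> j)"
    if "M \<in> carrier_mat n n" "i < n" "j < n" for M i j
  proof -
    have "M * transpose_mat S = transpose_mat (S * transpose_mat M)"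
      using S that by (simp add: transpose_mult[of _ n n _ n])
    then show ?thesis using SM[of "transpose_mat M" j i] that \<pi>(1) S by simp
  qed
  have "S * S' = 1\<^sub>m n"
  proof (rule eq_matI)
    fix i j assume "i < dim_row (1\<^sub>m n :: real mat)" "j < dim_col (1\<^sub>m n :: real mat)"
    then have ij: "i < n" "j < n" by auto
    then have "\<pi> i = \<pi> j \<longleftrightarrow> i = j" using inj_onD[OF \<pi>(2)] by auto
    then show "(S * S') $$ (i, j) = 1\<^sub>m n $$ (i, j)"
      unfolding SM[OF S' ij] using ij \<pi>(1)[OF ij(1)] d[OF ij(1)] by (auto simp: S'_def)
  qed (use S S' in auto)
  then show "invertible_mat S" by (rule invertible_matI[OF S S'])
  show "S * A * transpose_mat S = B"
  proof (rule eq_matI)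
    fix i j assume "i < dim_row B" "j < dim_col B"
    then have ij: "i < n" "j < n" using B by auto
    then show "(S * A * transpose_mat S) $$ (i, j) = B $$ (i, j)"
      unfolding AB[OF ij] MS[OF mult_carrier_mat[OF S A] ij] SM[OF A ij(1) \<pi>(1)[OF ij(2)]]
      by (simp add: mult.assoc mult.left_commute)
  qed (use S A B in auto)
qed

text \<open>Congruence by the block diagonal matrix of \<open>P\<close> and \<open>Q\<close> acts on
  the pair \<open>X\<close>, \<open>transpose_mat Y\<close> as a strict equivalence. Matrices of
  this shape can therefore be reduced like matrix pencils, with \<open>P\<close> and
  \<open>Q\<close> chosen independently.\<close>

lemma real_congruent_four_block:
  assumes X: "X \<in> carrier_mat m n" and Y: "Y \<in> carrier_mat n m"
    and P: "P \<in> carrier_mat m m" "invertible_mat P" and Q: "Q \<in> carrier_mat n n" "invertible_mat Q"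
    and X': "P * X * transpose_mat Q = X'" and Y': "Q * Y * transpose_mat P = Y'"
  shows "real_congruent (four_block_mat (0\<^sub>m m m) X Y (0\<^sub>m n n))
           (four_block_mat (0\<^sub>m m m) X' Y' (0\<^sub>m n n))"
proof (rule real_congruentI)
  obtain P' where P': "P' \<in> carrier_mat m m" "P * P' = 1\<^sub>m m" using invertible_matE[OF P(2,1)] .
  obtain Q' where Q': "Q' \<in> carrier_mat n n" "Q * Q' = 1\<^sub>m n" using invertible_matE[OF Q(2,1)] .
  let ?S = "four_block_mat P (0\<^sub>m m n) (0\<^sub>m n m) Q"
  let ?S' = "four_block_mat P' (0\<^sub>m m n) (0\<^sub>m n m) Q'"
  show S: "?S \<in> carrier_mat (m + n) (m + n)" using P Q by simp
  show "four_block_mat (0\<^sub>m m m) X Y (0\<^sub>m n n) \<in> carrier_mat (m + n) (m + n)" by simp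
  have "?S * ?S' = four_block_mat (1\<^sub>m m) (0\<^sub>m m n) (0\<^sub>m n m) (1\<^sub>m n)"
    using P P' Q Q' by (subst mult_four_block_mat[of _ m m _ n _ n _ _ m _ n]) auto
  then have "?S * ?S' = 1\<^sub>m (m + n)" by simp
  then show "invertible_mat ?S" using S P' Q' by (intro invertible_matI[OF S, of ?S']) auto
  have "?S * four_block_mat (0\<^sub>m m m) X Y (0\<^sub>m n n)
      = four_block_mat (0\<^sub>m m m) (P * X) (Q * Y) (0\<^sub>m n n)"
    using P Q X Y by (subst mult_four_block_mat[of _ m m _ n _ n _ _ m _ n]) auto
  moreover have "transpose_mat ?S
      = four_block_mat (transpose_mat P) (0\<^sub>m m n) (0\<^sub>m n m) (transpose_mat Q)"
    using P Q by (subst transpose_four_block_mat[of _ m m _ n _ n]) auto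
  moreover have "four_block_mat (0\<^sub>m m m) (P * X) (Q * Y) (0\<^sub>m n n)
        * four_block_mat (transpose_mat P) (0\<^sub>m m n) (0\<^sub>m n m) (transpose_mat Q)
      = four_block_mat (0\<^sub>m m m) X' Y' (0\<^sub>m n n)"
    using P Q X Y X' Y' by (subst mult_four_block_mat[of _ m m _ n _ n _ _ m _ n]) auto
  ultimately show "?S * four_block_mat (0\<^sub>m m m) X Y (0\<^sub>m n n) * transpose_mat ?S
      = four_block_mat (0\<^sub>m m m) X' Y' (0\<^sub>m n n)" by simp
qed

text \<open>Exchanging the two halves of the basis lets either off-diagonal block be the one that is
  reduced to the identity.\<close>

lemma real_congruent_swap:
  assumes X: "X \<in> carrier_mat n n" and Y: "Y \<in> carrier_mat n n"
  shows "real_congruent (four_block_mat (0\<^sub>m n n) X Y (0\<^sub>m n n))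
           (four_block_mat (0\<^sub>m n n) Y X (0\<^sub>m n n))"
  using assms
  by (intro real_congruent_monomial[where n = "n + n" and d = "\<lambda>_. 1"
        and \<pi> = "\<lambda>i. if i < n then i + n else i - n"])
     (auto simp: inj_on_def)

subsection \<open>Hankel forms on truncated power series\<close>

text \<open>With indices from 0, basis vector number \<open>a\<close> stands for x^(k-1-a), so the
  entry at \<open>(i, j)\<close> is the coefficient of x^(k-1) in x^(k-1-i) f x^(k-1-j). The guard
  prevents truncated subtraction from yielding a spurious constant coefficient.\<close>

definition hankel :: "nat \<Rightarrow> 'a::field fps \<Rightarrow> 'a mat" where
  "hankel k f = mat k k (\<lambda>(i, j). if k \<le> i + j + 1 then fps_nth f (i + j + 1 - k) else 0)"

text \<open>Row \<open>i\<close> holds the coordinates of \<open>p i\<close>; the reversed order of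
  the coefficients matches the basis behind \<open>hankel\<close>.\<close>

definition coeff_rows :: "nat \<Rightarrow> (nat \<Rightarrow> 'a::field fps) \<Rightarrow> 'a mat" where
  "coeff_rows k p = mat k k (\<lambda>(i, j). fps_nth (p i) (k - 1 - j))"

lemma hankel_carrier [simp]: "hankel k f \<in> carrier_mat k k"
  and coeff_rows_carrier [simp]: "coeff_rows k p \<in> carrier_mat k k"
  by (auto simp: hankel_def coeff_rows_def)

text \<open>Both products are convolutions. Entry \<open>a\<close> of the Hankel matrix applied to
  the coordinates of \<open>q j\<close> is coefficient \<open>a\<close> of \<open>f * q j\<close>,
  and pairing this with the reversed coefficients of \<open>p i\<close> gives the coefficient of
  degree \<open>k - 1\<close>.\<close>

lemma hankel_form:
  fixes f :: "'a::field fps"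
  assumes ij: "i < k" "j < k"
  shows "(coeff_rows k p * hankel k f * transpose_mat (coeff_rows k q)) $$ (i, j)
    = fps_nth (p i * f * q j) (k - 1)"
proof -
  have 1: "(hankel k f * transpose_mat (coeff_rows k q)) $$ (a, j) = fps_nth (f * q j) a"
    if a: "a < k" for a
  proof -
    have "(hankel k f * transpose_mat (coeff_rows k q)) $$ (a, j)
      = (\<Sum>b<k. hankel k f $$ (a, b) * transpose_mat (coeff_rows k q) $$ (b, j))"
      by (rule index_mult_mat_sum[of _ k k _ k]) (use a ij in auto)
    also have "\<dots> = (\<Sum>b<k. if k \<le> a + b + 1 then fps_nth f (a + b + 1 - k) * fps_nth (q j) (k - 1 - b) else 0)"
      using a ij by (intro sum.cong) (auto simp: hankel_def coeff_rows_def)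
    also have "\<dots> = (\<Sum>b\<in>{k - 1 - a..<k}. fps_nth f (a + b + 1 - k) * fps_nth (q j) (k - 1 - b))"
      using a by (intro sum.mono_neutral_cong_right) auto
    also have "\<dots> = (\<Sum>l\<in>{0..a}. fps_nth f l * fps_nth (q j) (a - l))"
      using a by (intro sum.reindex_bij_witness[of _ "\<lambda>l. k - 1 - a + l" "\<lambda>b. a + b + 1 - k"])
        (auto intro!: arg_cong2[of _ _ _ _ "\<lambda>x y. x * fps_nth (q j) y"])
    finally show ?thesis by (simp add: fps_mult_nth)
  qed
  have "coeff_rows k p * hankel k f * transpose_mat (coeff_rows k q)
    = coeff_rows k p * (hankel k f * transpose_mat (coeff_rows k q))"
    by (rule assoc_mult_mat[of _ k k _ k _ k]) auto
  also have "\<dots> $$ (i, j) = (\<Sum>a<k. coeff_rows k p $$ (i, a) * (hankel k f * transpose_mat (coeff_rows k q)) $$ (a, j))"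
    by (rule index_mult_mat_sum[of _ k k _ k]) (use ij in \<open>auto intro!: mult_carrier_mat[of _ k k]\<close>)
  also have "\<dots> = (\<Sum>a<k. fps_nth (p i) (k - 1 - a) * fps_nth (f * q j) a)"
    using ij by (intro sum.cong refl, subst 1) (auto simp: coeff_rows_def)
  also have "\<dots> = (\<Sum>l\<in>{0..k - 1}. fps_nth (p i) l * fps_nth (f * q j) (k - 1 - l))"
    using ij by (intro sum.reindex_bij_witness[of _ "\<lambda>l. k - 1 - l" "\<lambda>b. k - 1 - b"]) auto
  finally show ?thesis by (simp add: fps_mult_nth[of "p i"] mult.assoc)
qed

lemma hankel_form_eqI:
  assumes "M \<in> carrier_mat k k"
    "\<And>i j. i < k \<Longrightarrow> j < k \<Longrightarrow> fps_nth (p i * f * q j) (k - 1) = M $$ (i, j)"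
  shows "coeff_rows k p * hankel k f * transpose_mat (coeff_rows k q) = M"
proof (rule eq_matI)
  fix i j assume "i < dim_row M" "j < dim_col M"
  then have "i < k" "j < k" using assms(1) by auto
  then show "(coeff_rows k p * hankel k f * transpose_mat (coeff_rows k q)) $$ (i, j) = M $$ (i, j)"
    by (simp only: hankel_form assms(2))
qed (use assms(1) in \<open>auto simp: coeff_rows_def\<close>)

text \<open>This \<open>w\<close> is, up to order \<open>K\<close>, the series \<open>\<tau>' (x / \<tau>)\<^bsup>K+1\<^esup>\<close>, whose
  defining property is that the residue of \<open>\<tau>' \<tau>\<^bsup>m-K-1\<^esup>\<close> vanishes unless \<open>m = K\<close>.\<close>
lemma exists_residue_dual:
  fixes \<tau> :: "'a::field fps"
  assumes t0: "fps_nth \<tau> 0 = 0" and t1: "fps_nth \<tau> 1 \<noteq> 0"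
  obtains w where "\<And>m. fps_nth (w * \<tau> ^ m) K = (if m = K then 1 else 0)"
proof -
  \<comment> \<open>The conditions are imposed first for \<open>m \<ge> K\<close>, where a constant
    suffices, and then for smaller and smaller exponents, by correcting \<open>w\<close> in one
    higher degree at a time.\<close>
  have "\<exists>w. \<forall>m\<ge>K - n. fps_nth (w * \<tau> ^ m) K = (if m = K then 1 else 0)" if "n \<le> K" for n
    using that
  proof (induction n)
    case 0
    show ?case
    proof (intro exI allI impI)
      fix m assume "m \<ge> K - 0"
      then show "fps_nth (fps_const (1 / fps_nth \<tau> 1 ^ K) * \<tau> ^ m) K = (if m = K then 1 else 0)"
        using t0 t1 startsby_zero_power_prefix[OF t0] startsby_zero_power_nth_same[OF t0, of K]
        by auto
    qed
  next
    case (Suc n)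
    then obtain w where w: "\<And>m. m \<ge> K - n \<Longrightarrow> fps_nth (w * \<tau> ^ m) K = (if m = K then 1 else 0)"
      by auto
    define M where "M = K - Suc n"
    \<comment> \<open>The correction by a multiple of \<open>fps_X ^ Suc n\<close> leaves all
      exponents above \<open>M\<close> alone, since there \<open>\<tau> ^ m\<close> has no term of
      degree \<open>M\<close>; \<open>c\<close> cancels the unwanted value at the exponent
      \<open>M\<close> itself.\<close>
    define c where "c = - fps_nth (w * \<tau> ^ M) K / fps_nth \<tau> 1 ^ M"
    have X: "fps_nth (fps_X ^ Suc n * \<tau> ^ m) K = fps_nth (\<tau> ^ m) M" for m
      using Suc.prems unfolding M_def fps_X_power_mult_nth by auto
    show ?case
    proof (intro exI allI impI)
      fix m assume "m \<ge> K - Suc n"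
      then consider "m = M" | "m > M" "m \<ge> K - n" unfolding M_def using Suc.prems by linarith
      then show "fps_nth ((w + fps_const c * fps_X ^ Suc n) * \<tau> ^ m) K = (if m = K then 1 else 0)"
      proof cases
        case 1
        then show ?thesis
          using Suc.prems startsby_zero_power_nth_same[OF t0, of M] t1
          by (simp add: distrib_right mult.assoc X c_def M_def del: power_Suc)
      next
        case 2
        then show ?thesis
          using w[of m] startsby_zero_power_prefix[OF t0, of m]
          by (simp add: distrib_right mult.assoc X del: power_Suc)
      qed
    qed
  qed
  from this[of K] show ?thesis using that by auto
qed

text \<open>The hypotheses say that \<open>\<tau> = g / f - \<mu>\<close> vanishes to order exactly
  one. As \<open>g = f * (\<mu> + \<tau>)\<close>, two bases that are dual for the form of
  \<open>f\<close> and are built from powers of \<open>\<tau>\<close> turn the form of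
  \<open>g\<close> into \<open>\<mu>\<close> plus a shift.\<close>

lemma exists_hankel_pencil_reduction:
  fixes f g :: "'a::field fps"
  assumes f0: "fps_nth f 0 \<noteq> 0" and \<mu>: "fps_nth g 0 = \<mu> * fps_nth f 0"
    and g1: "fps_nth g 1 \<noteq> \<mu> * fps_nth f 1"
  obtains P Q where "P \<in> carrier_mat k k" "Q \<in> carrier_mat k k" "invertible_mat P" "invertible_mat Q"
    "P * hankel k f * transpose_mat Q = 1\<^sub>m k"
    "Q * hankel k g * transpose_mat P = jordan_block k \<mu>"
proof -
  define \<tau> where "\<tau> = (g - fps_const \<mu> * f) * inverse f"
  have inv: "f * inverse f = 1" using f0 by (rule inverse_mult_eq_1')
  have t0: "fps_nth \<tau> 0 = 0" using \<mu> by (simp add: \<tau>_def)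
  have "fps_nth \<tau> 1 = (fps_nth g 1 - \<mu> * fps_nth f 1) * inverse (fps_nth f 0)"
    using \<mu> by (simp add: \<tau>_def)
  then have t1: "fps_nth \<tau> 1 \<noteq> 0" using g1 f0 by simp
  have "f * (fps_const \<mu> + \<tau>) = fps_const \<mu> * f + (g - fps_const \<mu> * f) * (f * inverse f)"
    by (simp only: \<tau>_def distrib_left mult.assoc mult.commute mult.left_commute)
  then have g: "g = f * (fps_const \<mu> + \<tau>)" by (simp add: inv)
  obtain w where w: "\<And>m. fps_nth (w * \<tau> ^ m) (k - 1) = (if m = k - 1 then 1 else 0)"
    using exists_residue_dual[OF t0 t1] by metis
  \<comment> \<open>Descending powers on one side, ascending ones on the other:
    \<open>p i * f * q j\<close> is \<open>w\<close> times a power of \<open>\<tau>\<close> whose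
    exponent is \<open>k - 1\<close> exactly if \<open>i = j\<close>. The two sides are independent,
    so \<open>inverse f * w\<close> can sit in \<open>q\<close> as a whole.\<close>
  define p where "p i = \<tau> ^ (k - 1 - i)" for i
  define q where "q j = inverse f * w * \<tau> ^ j" for j
  let ?P = "coeff_rows k p" and ?Q = "coeff_rows k q"
  have "p i * f * q j = w * \<tau> ^ (k - 1 - i + j) * (f * inverse f)" for i j
    by (simp only: p_def q_def power_add mult.assoc mult.commute mult.left_commute)
  then have pfq: "p i * f * q j = w * \<tau> ^ (k - 1 - i + j)" for i j
    by (simp add: inv)
  have 1: "?P * hankel k f * transpose_mat ?Q = 1\<^sub>m k"
  proof (rule eq_matI)
    fix i j assume "i < dim_row (1\<^sub>m k :: 'a mat)" "j < dim_col (1\<^sub>m k :: 'a mat)"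
    then have ij: "i < k" "j < k" by auto
    show "(?P * hankel k f * transpose_mat ?Q) $$ (i, j) = 1\<^sub>m k $$ (i, j)"
      unfolding hankel_form[OF ij] pfq w using ij by auto
  qed (auto simp: coeff_rows_def)
  have 2: "?Q * hankel k g * transpose_mat ?P = jordan_block k \<mu>"
  proof (rule eq_matI)
    fix i j assume "i < dim_row (jordan_block k \<mu>)" "j < dim_col (jordan_block k \<mu>)"
    then have ij: "i < k" "j < k" by auto
    have "q i * g * p j = fps_const \<mu> * (p j * f * q i) + \<tau> * (p j * f * q i)"
      unfolding g by (simp add: algebra_simps)
    also have "\<dots> = fps_const \<mu> * (w * \<tau> ^ (k - 1 - j + i)) + w * \<tau> ^ Suc (k - 1 - j + i)"
      unfolding pfq by (simp add: algebra_simps)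
    finally have "fps_nth (q i * g * p j) (k - 1) = (if k - 1 - j + i = k - 1 then \<mu> else 0)
        + (if Suc (k - 1 - j + i) = k - 1 then 1 else 0)"
      by (simp only: fps_add_nth fps_mult_left_const_nth w) simp
    then show "(?Q * hankel k g * transpose_mat ?P) $$ (i, j) = jordan_block k \<mu> $$ (i, j)"
      unfolding hankel_form[OF ij] using ij by (auto simp: jordan_block_def)
  qed (auto simp: coeff_rows_def)
  have "?P * (hankel k f * transpose_mat ?Q) = 1\<^sub>m k"
    using 1 by (simp add: assoc_mult_mat[of _ k k _ k _ k])
  then have P: "invertible_mat ?P"
    by (intro invertible_matI[of _ k "hankel k f * transpose_mat ?Q"])
       (auto intro!: mult_carrier_mat[of _ k k])
  have C: "?P * hankel k f \<in> carrier_mat k k" and T: "transpose_mat ?Q \<in> carrier_mat k k"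
    by (auto intro!: mult_carrier_mat[of _ k k])
  \<comment> \<open>The invertibility of \<open>?Q\<close> comes from the same identity
    \<open>1\<close>, with its two factors exchanged and then transposed.\<close>
  have "transpose_mat (transpose_mat ?Q * (?P * hankel k f)) = 1\<^sub>m k"
    using mat_mult_left_right_inverse[OF C T 1] by simp
  then have "transpose_mat (?P * hankel k f) * ?Q = 1\<^sub>m k"
    using transpose_mult[OF T C] by simp
  from mat_mult_left_right_inverse[OF _ _ this]
  have Q: "invertible_mat ?Q"
    using C by (intro invertible_matI[of _ k "transpose_mat (?P * hankel k f)"]) auto
  from that[OF _ _ P Q 1 2] show ?thesis by simp
qed

lemma exists_fps_sqrt:
  fixes a :: "real fps"
  assumes "fps_nth a 0 > 0"
  obtains v where "v * v = a"
proof -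
  have "fps_radical (\<lambda>_. sqrt) (Suc 1) a ^ Suc 1 = a"
    by (subst power_radical[symmetric]) (use assms in auto)
  then show ?thesis using that by (simp add: power2_eq_square)
qed

text \<open>Here one matrix acts on both sides, so the rescaling factor \<open>w / p\<close> has to
  be split evenly as \<open>v * v\<close>. Positivity of its constant term makes the square root
  real.\<close>

lemma exists_hankel_symmetric_pencil_reduction:
  fixes p q :: "real fps"
  assumes p0: "fps_nth p 0 > 0" and q0: "fps_nth q 0 = 0" and q1: "fps_nth q 1 > 0"
  obtains S where "S \<in> carrier_mat k k" "invertible_mat S"
    "S * hankel k p * transpose_mat S = hankel k 1"
    "S * hankel k q * transpose_mat S = hankel k fps_X"
proof -
  define t where "t = q * inverse p"
  have inv: "p * inverse p = 1" using p0 by (intro inverse_mult_eq_1') simp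
  have t0: "fps_nth t 0 = 0" using q0 by (simp add: t_def)
  have t1: "fps_nth t 1 > 0" using q0 q1 p0 by (simp add: t_def)
  obtain w where w: "\<And>m. fps_nth (w * t ^ m) (k - 1) = (if m = k - 1 then 1 else 0)"
    using exists_residue_dual[OF t0, of "k - 1"] t1 by (metis less_irrefl)
  \<comment> \<open>Only the constant term of \<open>w\<close> contributes, because
    \<open>t ^ (k - 1)\<close> starts in degree \<open>k - 1\<close>. This determines the sign of
    that term.\<close>
  have "fps_nth (w * t ^ (k - 1)) (k - 1) = (\<Sum>i\<in>{0}. fps_nth w i * fps_nth (t ^ (k - 1)) (k - 1 - i))"
    unfolding fps_mult_nth using startsby_zero_power_prefix[OF t0, of "k - 1"]
    by (intro sum.mono_neutral_right) auto
  then have "fps_nth w 0 * fps_nth t 1 ^ (k - 1) = 1"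
    using w[of "k - 1"] startsby_zero_power_nth_same[OF t0, of "k - 1"] by simp
  then have "fps_nth w 0 > 0" using t1
    by (intro zero_less_mult_pos2[of "fps_nth w 0" "fps_nth t 1 ^ (k - 1)"]) auto
  then obtain v where v: "v * v = w * inverse p"
    using exists_fps_sqrt[of "w * inverse p"] p0 by auto
  define S where "S = coeff_rows k (\<lambda>i. v * t ^ (k - 1 - i))"
  \<comment> \<open>The same family in ascending order is dual to the one in \<open>S\<close> for
    the form of \<open>p\<close>; it serves to invert \<open>S\<close>.\<close>
  define U where "U = coeff_rows k (\<lambda>i. v * t ^ i)"
  have vp: "v * t ^ i * p * (v * t ^ j) = w * t ^ (i + j)" for i j
  proof -
    have "v * t ^ i * p * (v * t ^ j) = (v * v) * p * t ^ (i + j)" by (simp add: power_add mult_ac)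
    also have "\<dots> = w * (p * inverse p) * t ^ (i + j)" unfolding v by (simp only: mult_ac)
    finally show ?thesis by (simp add: inv)
  qed
  have vq: "v * t ^ i * q * (v * t ^ j) = w * t ^ Suc (i + j)" for i j
  proof -
    have q: "q = p * t" using inv by (simp add: t_def mult.left_commute)
    show ?thesis unfolding q using vp[of i "Suc j"] by (simp add: mult_ac)
  qed
  have S1: "S * hankel k p * transpose_mat S = hankel k 1"
    unfolding S_def
    by (rule hankel_form_eqI, simp, unfold vp w) (auto simp: hankel_def)
  have S2: "S * hankel k q * transpose_mat S = hankel k fps_X"
    unfolding S_def
    by (rule hankel_form_eqI, simp, unfold vq w) (auto simp: hankel_def)
  have "S * hankel k p * transpose_mat U = 1\<^sub>m k"
    unfolding S_def U_def
    by (rule hankel_form_eqI, simp, unfold vp w) (auto simp: hankel_def)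
  then have "S * (hankel k p * transpose_mat U) = 1\<^sub>m k"
    by (simp add: S_def U_def assoc_mult_mat[of _ k k _ k _ k])
  then have "invertible_mat S"
    by (intro invertible_matI[of _ k "hankel k p * transpose_mat U"])
       (auto simp: S_def U_def intro!: mult_carrier_mat[of _ k k])
  with S1 S2 show ?thesis by (intro that[of S]) (auto simp: S_def)
qed

section \<open>The block alpha3 and the nilpotent case of H\<close>

lemma Delta_mat_eq_hankel: "Delta_mat k = hankel k 1"
  by (rule eq_matI) (auto simp: Delta_mat_def mat1_def hankel_def)

lemma Lambda_mat_eq_hankel: "Lambda_mat k = hankel k fps_X"
  by (rule eq_matI) (auto simp: Lambda_mat_def mat1_def hankel_def)

text \<open>The nonzero entries form a directed path that alternates between the two halves of the
  basis. Renumbering along the path interleaves the halves and gives the nilpotent Jordan block. The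
  case \<open>m = n\<close> serves H, the case \<open>m = n + 1\<close> serves m3.\<close>

lemma real_congruent_bipartite_path:
  assumes E: "E \<in> carrier_mat m n" and F: "F \<in> carrier_mat n m"
    and Eij: "\<And>i j. i < m \<Longrightarrow> j < n \<Longrightarrow> E $$ (i, j) = (if i = j then 1 else 0)"
    and Fij: "\<And>i j. i < n \<Longrightarrow> j < m \<Longrightarrow> F $$ (i, j) = (if j = i + 1 then 1 else 0)"
    and mn: "m = n \<or> m = n + 1"
  shows "real_congruent (four_block_mat (0\<^sub>m m m) E F (0\<^sub>m n n)) (jordan_block (m + n) 0)"
proof (rule real_congruent_monomial[where d = "\<lambda>_. 1" and n = "m + n"
      and \<pi> = "\<lambda>i. if even i then i div 2 else m + i div 2"])
  show "inj_on (\<lambda>i. if even i then i div 2 else m + i div 2) {..<m + n}"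
  proof (rule inj_onI)
    fix i j assume "i \<in> {..<m + n}" "j \<in> {..<m + n}"
      "(if even i then i div 2 else m + i div 2) = (if even j then j div 2 else m + j div 2)"
    then show "i = j" using mn by (auto split: if_splits elim!: evenE oddE)
  qed
next
  fix i assume "i < m + n"
  moreover have "i = 2 * (i div 2) \<or> i = 2 * (i div 2) + 1" by presburger
  ultimately have "i div 2 < m" "odd i \<Longrightarrow> i div 2 < n" using mn by (auto elim!: oddE)
  then show "(if even i then i div 2 else m + i div 2) < m + n" by auto
next
  fix i j assume ij: "i < m + n" "j < m + n"
  define a b where "a = i div 2" and "b = j div 2"
  have i: "i = 2 * a \<and> a < m \<or> i = 2 * a + 1 \<and> a < n" and j: "j = 2 * b \<and> b < m \<or> j = 2 * b + 1 \<and> b < n"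
    using ij mn unfolding a_def b_def by (auto elim!: evenE oddE)
  have "2 * a + 1 = 2 * b \<longleftrightarrow> False" "Suc (2 * a + 1) = 2 * b \<longleftrightarrow> b = a + 1" by presburger+
  then show "jordan_block (m + n) 0 $$ (i, j) = 1 * 1 * four_block_mat (0\<^sub>m m m) E F (0\<^sub>m n n) $$
      (if even i then i div 2 else m + i div 2, if even j then j div 2 else m + j div 2)"
    using i j ij carrier_matD[OF E] carrier_matD[OF F]
    by (elim disjE conjE) (auto simp add: jordan_block_def Eij Fij)
qed (use E F in auto)

lemma real_congruent_H_mat_0: "real_congruent (H_mat k 0) (jordan_block (2 * k) 0)"
  unfolding H_mat_def mult_2
  by (rule real_congruent_bipartite_path) (auto simp: jordan_block_def)

lemma real_congruent_lw_alpha3: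
  assumes "\<alpha> > 0"
  shows "real_congruent (lw_alpha3 \<alpha> k) (H_mat k ((1 - \<alpha>) / (1 + \<alpha>)))"
proof -
  define \<mu> where "\<mu> = (1 - \<alpha>) / (1 + \<alpha>)"
  define f where "f = fps_const (\<alpha> + 1) + fps_X"
  define g where "g = fps_const (1 - \<alpha>) - fps_X"
  \<comment> \<open>The last condition amounts to \<open>\<mu> \<noteq> -1\<close>, which holds
    because \<open>\<mu> + 1 = 2 / (1 + \<alpha>)\<close>.\<close>
  have "fps_nth f 0 \<noteq> 0" "fps_nth g 0 = \<mu> * fps_nth f 0" "fps_nth g 1 \<noteq> \<mu> * fps_nth f 1"
    using assms by (auto simp: f_def g_def \<mu>_def field_simps)
  from exists_hankel_pencil_reduction[OF this, where k = k] obtain P Q where PQ: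
    "P \<in> carrier_mat k k" "Q \<in> carrier_mat k k" "invertible_mat P" "invertible_mat Q"
    "P * hankel k f * transpose_mat Q = 1\<^sub>m k" "Q * hankel k g * transpose_mat P = jordan_block k \<mu>"
    by metis
  have X: "(\<alpha> + 1) \<cdot>\<^sub>m Delta_mat k + Lambda_mat k = hankel k f"
    unfolding Delta_mat_eq_hankel Lambda_mat_eq_hankel
    by (rule eq_matI) (auto simp: hankel_def f_def)
  have Y: "(- \<alpha> + 1) \<cdot>\<^sub>m Delta_mat k - Lambda_mat k = hankel k g"
    unfolding Delta_mat_eq_hankel Lambda_mat_eq_hankel
    by (rule eq_matI) (auto simp: hankel_def g_def)
  show ?thesis
    unfolding lw_alpha3_def H_mat_def X Y \<mu>_def[symmetric]
    by (rule real_congruent_four_block[OF _ _ PQ(1,3,2,4-)]) auto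
qed

subsection \<open>The block m3\<close>

text \<open>These are the monomials x^j, j < n, after the substitution of (1 - x) / (1 + x), cleared
  of denominators by (1 + x)^(n-1). Their coefficient matrix \<open>cayley_mat\<close> is the
  Krawtchouk matrix.\<close>

definition cayley_poly :: "nat \<Rightarrow> nat \<Rightarrow> real poly" where
  "cayley_poly n j = [:1, -1:] ^ j * [:1, 1:] ^ (n - 1 - j)"

definition cayley_mat :: "nat \<Rightarrow> real mat" where
  "cayley_mat n = mat n n (\<lambda>(i, j). coeff (cayley_poly n j) i)"

lemma cayley_mat_carrier [simp]: "cayley_mat n \<in> carrier_mat n n"
  by (simp add: cayley_mat_def)

lemma degree_cayley_poly: "j < n \<Longrightarrow> degree (cayley_poly n j) < n"
proof -
  assume "j < n"
  have "degree (cayley_poly n j) \<le> j * 1 + (n - 1 - j) * 1"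
    unfolding cayley_poly_def
    by (intro order.trans[OF degree_mult_le] add_mono order.trans[OF degree_power_le]) auto
  then show ?thesis using \<open>j < n\<close> by simp
qed

lemma coeff_cayley_poly_eq_0: "j < n \<Longrightarrow> n \<le> i \<Longrightarrow> coeff (cayley_poly n j) i = 0"
  by (intro coeff_eq_0) (use degree_cayley_poly[of j n] in auto)

text \<open>The Moebius map \<open>x \<mapsto> (1 - x) / (1 + x)\<close> is an involution.\<close>
lemma cayley_poly_involution:
  assumes j: "j < n"
  shows "(\<Sum>i<n. Polynomial.smult (coeff (cayley_poly n j) i) (cayley_poly n i)) = Polynomial.monom (2 ^ (n - 1)) j"
    (is "?l = ?r")
proof -
  have eval: "poly ?l x = poly ?r x" if x: "1 + x \<noteq> 0" for x
  proof -
    define y where "y = (1 - x) / (1 + x)"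
    have xn: "(1 - x) ^ i * (1 + x) ^ (n - 1 - i) = (1 + x) ^ (n - 1) * y ^ i" if "i < n" for i
    proof -
      have "(1 + x) ^ (n - 1) = (1 + x) ^ (n - 1 - i) * (1 + x) ^ i"
        using that by (simp flip: power_add)
      then show ?thesis using x by (simp add: y_def power_divide)
    qed
    have "poly ?l x = (\<Sum>i<n. coeff (cayley_poly n j) i * ((1 - x) ^ i * (1 + x) ^ (n - 1 - i)))"
      by (simp add: poly_sum cayley_poly_def)
    also have "\<dots> = (\<Sum>i<n. (1 + x) ^ (n - 1) * (coeff (cayley_poly n j) i * y ^ i))"
      by (intro sum.cong refl) (simp only: xn lessThan_iff mult.left_commute)
    also have "\<dots> = (1 + x) ^ (n - 1) * (\<Sum>i<n. coeff (cayley_poly n j) i * y ^ i)"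
      by (simp add: sum_distrib_left)
    also have "(\<Sum>i<n. coeff (cayley_poly n j) i * y ^ i) = poly (cayley_poly n j) y"
      unfolding poly_altdef using degree_cayley_poly[OF j]
      by (intro sum.mono_neutral_right) (auto intro: coeff_eq_0)
    also have "\<dots> = (1 - y) ^ j * (1 + y) ^ (n - 1 - j)" by (simp add: cayley_poly_def)
    also have "1 - y = 2 * x / (1 + x)" using x by (simp add: y_def field_simps)
    also have "1 + y = 2 / (1 + x)" using x by (simp add: y_def field_simps)
    also have "(1 + x) ^ (n - 1) * ((2 * x / (1 + x)) ^ j * (2 / (1 + x)) ^ (n - 1 - j)) = 2 ^ (n - 1) * x ^ j"
    proof -
      have "n - 1 = j + (n - 1 - j)" using j by simp
      then obtain l where l: "n - 1 = j + l" "n - 1 - j = l" by blast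
      show ?thesis using x unfolding l by (simp add: power_add power_divide power_mult_distrib)
    qed
    finally show ?thesis by (simp add: poly_monom)
  qed
  \<comment> \<open>The evaluation excludes the point -1. Multiplication by 1 + x makes the
    difference vanish there too, and the factor cancels afterwards.\<close>
  have "(?l - ?r) * [:1, 1:] = 0"
  proof (subst poly_all_0_iff_0[symmetric], intro allI)
    fix x
    have "poly ((?l - ?r) * [:1, 1:]) x = (poly ?l x - poly ?r x) * (1 + x)"
      by (simp only: poly_mult poly_diff) simp
    then show "poly ((?l - ?r) * [:1, 1:]) x = 0" using eval[of x] by (cases "1 + x = 0") simp_all
  qed
  then show ?thesis by (metis mult_eq_0_iff pCons_eq_0_iff right_minus_eq zero_neq_one)
qed

lemma cayley_mat_square: "cayley_mat n * cayley_mat n = 2 ^ (n - 1) \<cdot>\<^sub>m 1\<^sub>m n"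
proof (rule eq_matI)
  fix l j assume "l < dim_row (2 ^ (n - 1) \<cdot>\<^sub>m 1\<^sub>m n :: real mat)" "j < dim_col (2 ^ (n - 1) \<cdot>\<^sub>m 1\<^sub>m n :: real mat)"
  then have lj: "l < n" "j < n" by auto
  have "(cayley_mat n * cayley_mat n) $$ (l, j) = (\<Sum>i<n. cayley_mat n $$ (l, i) * cayley_mat n $$ (i, j))"
    by (rule index_mult_mat_sum[of _ n n _ n]) (use lj in auto)
  also have "\<dots> = coeff (\<Sum>i<n. Polynomial.smult (coeff (cayley_poly n j) i) (cayley_poly n i)) l"
    using lj by (simp add: coeff_sum cayley_mat_def mult.commute)
  also have "\<dots> = (2 ^ (n - 1) \<cdot>\<^sub>m 1\<^sub>m n) $$ (l, j)"
    unfolding cayley_poly_involution[OF lj(2)] using lj by auto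
  finally show "(cayley_mat n * cayley_mat n) $$ (l, j) = (2 ^ (n - 1) \<cdot>\<^sub>m 1\<^sub>m n) $$ (l, j)" .
qed (auto simp: cayley_mat_def)

lemma coeff_linear_mult: "coeff ([:1, c:] * p) i = coeff p i + (if i = 0 then 0 else c * coeff p (i - 1))"
  for p :: "real poly"
  by (cases i) (auto simp: coeff_pCons)

text \<open>\<open>U\<close> is multiplication by 1 + c x, from polynomials of degree below
  \<open>k\<close> to those of degree below \<open>k + 1\<close>, in the monomial bases.
  \<open>L_mat\<close> is the case \<open>c = 1\<close>, the transpose of \<open>L_plus\<close> the
  case \<open>c = -1\<close>.\<close>

lemma bidiagonal_mult_cayley_mat:
  assumes U: "\<And>i j. i < k + 1 \<Longrightarrow> j < k \<Longrightarrow> U $$ (i, j) = (if i = j then 1 else if i = j + 1 then c else 0)"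
    and U_carrier: "U \<in> carrier_mat (k + 1) k" and ij: "i < k + 1" "j < k"
  shows "(U * cayley_mat k) $$ (i, j) = coeff ([:1, c:] * cayley_poly k j) i"
proof -
  have "(U * cayley_mat k) $$ (i, j) = (\<Sum>l<k. U $$ (i, l) * cayley_mat k $$ (l, j))"
    by (rule index_mult_mat_sum[OF U_carrier _ ij]) simp
  also have "\<dots> = (\<Sum>l<k. (if l = i then coeff (cayley_poly k j) i else 0)
      + (if l = i - 1 \<and> i \<noteq> 0 then c * coeff (cayley_poly k j) (i - 1) else 0))"
    using ij by (intro sum.cong) (auto simp: U cayley_mat_def)
  also have "\<dots> = coeff ([:1, c:] * cayley_poly k j) i"
    using ij coeff_cayley_poly_eq_0[OF ij(2), of i]
    by (cases i) (auto simp: sum.distrib coeff_linear_mult simp del: mult_pCons_left)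
  finally show ?thesis .
qed

text \<open>Multiplication by 1 + x takes \<open>cayley_poly k j\<close> to
  \<open>cayley_poly (k + 1) j\<close>, and multiplication by 1 - x takes it to
  \<open>cayley_poly (k + 1) (j + 1)\<close>. In these bases \<open>L_mat\<close> and the transpose
  of \<open>L_plus\<close> become the two shifts \<open>E\<close> and \<open>F\<close>, which form a
  path.\<close>

lemma real_congruent_lw_m3: "real_congruent (lw_m3 k) (jordan_block (2 * k + 1) 0)"
proof -
  define E :: "real mat" where "E = mat (k + 1) k (\<lambda>(i, j). if i = j then 1 else 0)"
  define F :: "real mat" where "F = mat (k + 1) k (\<lambda>(i, j). if i = j + 1 then 1 else 0)"
  let ?C = "cayley_mat (k + 1)" and ?D = "cayley_mat k"
  \<comment> \<open>This is the inverse of \<open>?C\<close>, whose square is \<open>2 ^ k\<close>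
    times the identity.\<close>
  define P where "P = (1 / 2 ^ k) \<cdot>\<^sub>m ?C"
  have carr: "E \<in> carrier_mat (k + 1) k" "F \<in> carrier_mat (k + 1) k" "P \<in> carrier_mat (k + 1) (k + 1)"
    "L_mat k \<in> carrier_mat (k + 1) k" "L_plus k \<in> carrier_mat k (k + 1)"
    by (auto simp: E_def F_def P_def L_mat_def L_plus_def mat1_def)
  have PC: "P * ?C = 1\<^sub>m (k + 1)"
    unfolding P_def by (subst mult_smult_assoc_mat[of _ "k + 1" "k + 1" _ "k + 1"])
      (auto simp: cayley_mat_square intro!: eq_matI)
  have "?D * ((1 / 2 ^ (k - 1)) \<cdot>\<^sub>m ?D) = 1\<^sub>m k"
    by (subst mult_smult_distrib[of _ k k _ k]) (auto simp: cayley_mat_square intro!: eq_matI)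
  then have D: "invertible_mat ?D" by (intro invertible_matI) auto
  have P: "invertible_mat P" using PC carr by (intro invertible_matI[of _ "k + 1" ?C]) auto
  obtain D' where D': "D' \<in> carrier_mat k k" "?D * D' = 1\<^sub>m k" "D' * ?D = 1\<^sub>m k"
    using invertible_matE[OF D cayley_mat_carrier] .
  have DT: "invertible_mat (transpose_mat ?D)"
    by (rule invertible_matI[of _ k "transpose_mat D'"])
      (use D' in \<open>auto simp flip: transpose_mult[of _ k k _ k]\<close>)
  have CM: "(?C * M) $$ (i, j) = cayley_mat (k + 1) $$ (i, a)"
    if "M \<in> carrier_mat (k + 1) k" "i < k + 1" "j < k" "a < k + 1"
      "\<And>l. l < k + 1 \<Longrightarrow> M $$ (l, j) = (if l = a then 1 else 0)" for M i j a
  proof -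
    have "(?C * M) $$ (i, j) = (\<Sum>l<k + 1. ?C $$ (i, l) * M $$ (l, j))"
      by (rule index_mult_mat_sum[OF _ that(1-3)]) simp
    also have "\<dots> = (\<Sum>l<k + 1. if l = a then ?C $$ (i, l) else 0)"
      by (intro sum.cong) (auto simp: that)
    finally show ?thesis using that(4) by simp
  qed
  have LD: "L_mat k * ?D = ?C * E"
  proof (rule eq_matI)
    fix i j assume "i < dim_row (?C * E)" "j < dim_col (?C * E)"
    then have ij: "i < k + 1" "j < k" using carr by (auto simp: cayley_mat_def)
    have "k - j = Suc (k - 1 - j)" using ij by simp
    then have "[:1, 1:] * cayley_poly k j = cayley_poly (k + 1) j"
      unfolding cayley_poly_def by (simp only: power_Suc diff_add_inverse2 mult.left_commute)
    then have "(L_mat k * ?D) $$ (i, j) = coeff (cayley_poly (k + 1) j) i"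
      using bidiagonal_mult_cayley_mat[OF _ carr(4) ij, of 1] by (simp add: L_mat_def mat1_def)
    then show "(L_mat k * ?D) $$ (i, j) = (?C * E) $$ (i, j)"
      using ij by (subst CM[of _ _ _ j]) (auto simp: carr, auto simp: E_def cayley_mat_def)
  qed (use carr in \<open>auto simp: cayley_mat_def\<close>)
  have LpD: "transpose_mat (L_plus k) * ?D = ?C * F"
  proof (rule eq_matI)
    fix i j assume "i < dim_row (?C * F)" "j < dim_col (?C * F)"
    then have ij: "i < k + 1" "j < k" using carr by (auto simp: cayley_mat_def)
    have "[:1, -1:] * cayley_poly k j = cayley_poly (k + 1) (j + 1)"
    proof -
      have "k + 1 - 1 - (j + 1) = k - 1 - j" by simp
      then show ?thesis
        unfolding cayley_poly_def by (simp only: power_add power_one_right mult_ac)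
    qed
    then have "(transpose_mat (L_plus k) * ?D) $$ (i, j) = coeff (cayley_poly (k + 1) (j + 1)) i"
      using bidiagonal_mult_cayley_mat[of k "transpose_mat (L_plus k)" "-1" i j] ij carr
      by (simp add: L_plus_def mat1_def)
    then show "(transpose_mat (L_plus k) * ?D) $$ (i, j) = (?C * F) $$ (i, j)"
      using ij by (subst CM[of _ _ _ "j + 1"]) (auto simp: carr, auto simp: F_def cayley_mat_def)
  qed (use carr in \<open>auto simp: cayley_mat_def\<close>)
  have PCM: "P * (?C * M) = M" if "M \<in> carrier_mat (k + 1) k" for M
    using that carr PC by (simp flip: assoc_mult_mat[of _ "k + 1" "k + 1" _ "k + 1" _ k])
  have PL: "P * L_mat k * transpose_mat (transpose_mat ?D) = E"
    using carr PCM by (simp add: LD assoc_mult_mat[of _ "k + 1" "k + 1" _ k _ k])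
  have "transpose_mat ?D * L_plus k * transpose_mat P = transpose_mat (P * (transpose_mat (L_plus k) * ?D))"
    using carr by (simp add: transpose_mult[of _ "k + 1" "k + 1" _ k] transpose_mult[of _ "k + 1" k _ k])
  also have "\<dots> = transpose_mat F" using PCM carr by (simp add: LpD)
  finally have "real_congruent (lw_m3 k) (four_block_mat (0\<^sub>m (k + 1) (k + 1)) E (transpose_mat F) (0\<^sub>m k k))"
    unfolding lw_m3_def using carr P DT PL by (intro real_congruent_four_block) auto
  moreover have "real_congruent (four_block_mat (0\<^sub>m (k + 1) (k + 1)) E (transpose_mat F) (0\<^sub>m k k))
      (jordan_block (k + 1 + k) 0)"
    using carr by (intro real_congruent_bipartite_path) (auto simp: E_def F_def)
  moreover have "k + 1 + k = 2 * k + 1" by simp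
  ultimately show ?thesis using real_congruent_trans by metis
qed

subsection \<open>Signed permutations\<close>

lemma mat_2x2_index [simp]:
  "mat_2x2 p q r s $$ (0, 0) = p" "mat_2x2 p q r s $$ (0, Suc 0) = q"
  "mat_2x2 p q r s $$ (Suc 0, 0) = r" "mat_2x2 p q r s $$ (Suc 0, Suc 0) = s"
  by (simp_all add: mat_2x2_def mat_of_rows_list_def)

lemma mat_2x2_dim [simp]: "dim_row (mat_2x2 p q r s) = 2" "dim_col (mat_2x2 p q r s) = 2"
  by (simp_all add: mat_2x2_def mat_of_rows_list_def)

lemma kronecker_C_mat:
  assumes "A \<in> carrier_mat k k"
  shows "A \<otimes>\<^sub>K C_mat p q = mat (2 * k) (2 * k)
    (\<lambda>(i, j). A $$ (i div 2, j div 2) * C_mat p q $$ (i mod 2, j mod 2))"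
  using assms unfolding kronecker_def by (auto simp: C_mat_def mult.commute)

lemma Gamma_mat_carrier [simp]: "Gamma_mat k \<in> carrier_mat k k"
  by (simp add: Gamma_mat_def mat1_def)

lemma Gamma_kronecker_mat_1x1:
  "Gamma_mat k \<otimes>\<^sub>K mat_1x1 c = mat k k (\<lambda>(i, j).
     if i + j + 1 = k \<or> i + j = k then c * (-1) ^ (k - 1 - i) else 0)"
  by (rule eq_matI)
     (auto simp: kronecker_def mat_1x1_def mat_of_rows_list_def Gamma_mat_def mat1_def)

lemma real_congruent_signs:
  assumes "A \<in> carrier_mat n n" "B \<in> carrier_mat n n" "\<And>i. i < n \<Longrightarrow> d i \<noteq> 0"
    "\<And>i j. i < n \<Longrightarrow> j < n \<Longrightarrow> B $$ (i, j) = d i * d j * A $$ (i, j)"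
  shows "real_congruent A B"
  using assms by (intro real_congruent_monomial[where \<pi> = "\<lambda>i. i" and n = n and d = d]) auto

lemma S_Delta_even: "S_Delta (2 * l) = mat (2 * l) (2 * l) (\<lambda>(i, j).
    if i + j + 1 = 2 * l then if i < l then 1 else -1 else 0)"
  by (rule eq_matI) (auto simp: S_Delta_def skew_Delta_def Delta_mat_def mat1_def)

text \<open>The extra zero row and column move the skew antidiagonal onto the support of
  \<open>Lambda_mat\<close>. So \<open>Delta_mat + S_Delta\<close> in odd size, like
  \<open>S_Delta + Lambda_mat\<close> in even size, has the support of \<open>Gamma_mat\<close>, and
  only signs have to be adjusted.\<close>

lemma S_Delta_odd: "S_Delta (2 * l + 1) = mat (2 * l + 1) (2 * l + 1) (\<lambda>(i, j).
    if i + j = 2 * l + 1 then if i \<le> l then 1 else -1 else 0)"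
  by (rule eq_matI) (auto simp: S_Delta_def skew_Delta_def Delta_mat_def mat1_def)

text \<open>Sign changes of basis vectors preserve diagonal entries. For \<open>l > 0\<close> the
  only nonzero one is at \<open>(l, l)\<close>, counted from 0, and it forces the sign of the scalar
  in the target. The signs in \<open>d\<close> are then placed on the first half alone.\<close>

lemma real_congruent_lw_inf4:
  assumes "even k"
  shows "real_congruent (lw_inf4 \<epsilon> k) (Gamma_mat k \<otimes>\<^sub>K mat_1x1 (\<epsilon> * (-1) ^ (k div 2 + 1)))"
proof -
  obtain l where k: "k = 2 * l" using assms by auto
  define d :: "nat \<Rightarrow> real" where "d i = (if i < l then (-1) ^ (l + i) else 1)" for i
  show ?thesis
    unfolding k Gamma_kronecker_mat_1x1 lw_inf4_def S_Delta_even
  proof (rule real_congruent_signs[where d = d])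
    fix i j assume ij: "i < 2 * l" "j < 2 * l"
    have par: "i + j + 1 = 2 * l \<Longrightarrow> even j \<longleftrightarrow> odd i" "i + j = 2 * l \<Longrightarrow> even j \<longleftrightarrow> even i"
      by presburger+
    consider "i + j + 1 = 2 * l" "i < l" | "i + j + 1 = 2 * l" "i \<ge> l"
      | "i + j = 2 * l" "i < l" | "i + j = 2 * l" "i = l" | "i + j = 2 * l" "i > l"
      | "i + j + 1 \<noteq> 2 * l" "i + j \<noteq> 2 * l"
      using less_linear[of i l] leI[of i l] by blast
    then show "mat (2 * l) (2 * l) (\<lambda>(i, j). if i + j + 1 = 2 * l \<or> i + j = 2 * l
        then \<epsilon> * (-1) ^ (2 * l div 2 + 1) * (-1) ^ (2 * l - 1 - i) else 0) $$ (i, j)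
      = d i * d j * (\<epsilon> \<cdot>\<^sub>m (mat (2 * l) (2 * l) (\<lambda>(i, j). if i + j + 1 = 2 * l
        then if i < l then 1 else - 1 else 0) + Lambda_mat (2 * l))) $$ (i, j)"
      by cases (use ij par in \<open>simp_all add: Lambda_mat_def mat1_def d_def minus_one_power_iff\<close>)
  qed (auto simp: d_def Lambda_mat_def mat1_def)
qed

lemma real_congruent_lw_o3:
  assumes "odd k"
  shows "real_congruent (lw_o3 \<epsilon> k) (Gamma_mat k \<otimes>\<^sub>K mat_1x1 (\<epsilon> * (-1) ^ ((k - 1) div 2)))"
proof -
  obtain l where k: "k = 2 * l + 1" using assms by (rule oddE)
  define d :: "nat \<Rightarrow> real" where "d i = (if i < l then (-1) ^ (l + i) else 1)" for i
  show ?thesis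
    unfolding k Gamma_kronecker_mat_1x1 lw_o3_def S_Delta_odd
  proof (rule real_congruent_signs[where d = d])
    fix i j assume ij: "i < 2 * l + 1" "j < 2 * l + 1"
    \<comment> \<open>The third fact concerns the position \<open>i = l + 1\<close>,
      \<open>j = l\<close>, where \<open>d\<close> is \<open>1\<close> at both indices.\<close>
    have par: "i + j = 2 * l \<Longrightarrow> even j \<longleftrightarrow> even i" "i + j = 2 * l + 1 \<Longrightarrow> even j \<longleftrightarrow> odd i"
      "i + j = 2 * l + 1 \<Longrightarrow> l < i \<Longrightarrow> \<not> j < l \<Longrightarrow> even i \<longleftrightarrow> odd l"
      by presburger+
    consider "i + j = 2 * l" "i < l" | "i + j = 2 * l" "i = l" | "i + j = 2 * l" "i > l"
      | "i + j = 2 * l + 1" "i < l" | "i + j = 2 * l + 1" "i = l" | "i + j = 2 * l + 1" "i > l"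
      | "i + j \<noteq> 2 * l" "i + j \<noteq> 2 * l + 1"
      using less_linear[of i l] by blast
    then show "mat (2 * l + 1) (2 * l + 1) (\<lambda>(i, j). if i + j + 1 = 2 * l + 1 \<or> i + j = 2 * l + 1
        then \<epsilon> * (-1) ^ ((2 * l + 1 - 1) div 2) * (-1) ^ (2 * l + 1 - 1 - i) else 0) $$ (i, j)
      = d i * d j * (\<epsilon> \<cdot>\<^sub>m (Delta_mat (2 * l + 1) + mat (2 * l + 1) (2 * l + 1) (\<lambda>(i, j).
        if i + j = 2 * l + 1 then if i \<le> l then 1 else - 1 else 0))) $$ (i, j)"
      by cases (use ij par in \<open>simp_all add: Delta_mat_def mat1_def d_def minus_one_power_iff\<close>)
  qed (auto simp: d_def Delta_mat_def mat1_def)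
qed

text \<open>The shape of \<open>Y\<close> is that of inf5 for odd \<open>k\<close> and that of o4
  for even \<open>k\<close>. Interleaving the halves puts \<open>X\<close> into the upper right and
  \<open>Y\<close> into the lower left corners of the 2 x 2 blocks; the row signs of
  \<open>Gamma_mat\<close> are absorbed by alternating signs on the first half.\<close>

lemma real_congruent_Gamma_kronecker_C_0_1:
  assumes X: "X \<in> carrier_mat k k" and Y: "Y \<in> carrier_mat k k"
    and Xij: "\<And>i j. i < k \<Longrightarrow> j < k \<Longrightarrow> X $$ (i, j) = (if i + j + 1 = k \<or> i + j = k then 1 else 0)"
    and Yij: "\<And>i j. i < k \<Longrightarrow> j < k \<Longrightarrow> Y $$ (i, j) =
      (if i + j + 1 = k then (-1) ^ k else if i + j = k then (-1) ^ (k + 1) else 0)"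
  shows "real_congruent (four_block_mat (0\<^sub>m k k) X Y (0\<^sub>m k k)) (Gamma_mat k \<otimes>\<^sub>K C_mat 0 1)"
proof (rule real_congruent_monomial[where n = "2 * k" and \<pi> = "\<lambda>i. if even i then i div 2 else k + i div 2"
      and d = "\<lambda>i. if even i then (-1) ^ (i div 2 + 1) else (-1) ^ k"])
  show "inj_on (\<lambda>i. if even i then i div 2 else k + i div 2) {..<2 * k}"
    by (rule inj_onI) (auto split: if_splits elim!: evenE oddE)
next
  fix i assume "i < 2 * k"
  then show "(if even i then i div 2 else k + i div 2) < 2 * k" by auto
next
  fix i j assume ij: "i < 2 * k" "j < 2 * k"
  define a b where "a = i div 2" and "b = j div 2"
  have "i = 2 * a \<and> a < k \<or> i = 2 * a + 1 \<and> a < k" and "j = 2 * b \<and> b < k \<or> j = 2 * b + 1 \<and> b < k"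
    using ij unfolding a_def b_def by presburger+
  moreover have par: "a + b + 1 = k \<Longrightarrow> even k \<longleftrightarrow> (even b \<longleftrightarrow> odd a)" "a + b = k \<Longrightarrow> even k \<longleftrightarrow> (even b \<longleftrightarrow> even a)"
    by presburger+
  ultimately show "(Gamma_mat k \<otimes>\<^sub>K C_mat 0 1) $$ (i, j)
    = (if even i then (-1) ^ (i div 2 + 1) else (-1) ^ k) * (if even j then (-1) ^ (j div 2 + 1) else (-1) ^ k)
      * four_block_mat (0\<^sub>m k k) X Y (0\<^sub>m k k) $$
        (if even i then i div 2 else k + i div 2, if even j then j div 2 else k + j div 2)"
    unfolding kronecker_C_mat[OF Gamma_mat_carrier]
    using carrier_matD[OF X] carrier_matD[OF Y]
    by (elim disjE conjE)
       (simp_all add: Xij Yij C_mat_def Gamma_mat_def mat1_def minus_one_power_iff par)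
qed (use X Y in \<open>auto simp: kronecker_C_mat[of _ k]\<close>)

lemma real_congruent_lw_inf5:
  assumes "odd k"
  shows "real_congruent (lw_inf5 k) (Gamma_mat k \<otimes>\<^sub>K C_mat 0 1)"
  unfolding lw_inf5_def
  using assms by (intro real_congruent_Gamma_kronecker_C_0_1) (auto simp: Delta_mat_def Lambda_mat_def mat1_def)

lemma real_congruent_lw_o4:
  assumes "even k"
  shows "real_congruent (lw_o4 k) (Gamma_mat k \<otimes>\<^sub>K C_mat 0 1)"
  unfolding lw_o4_def
  using assms by (intro real_congruent_Gamma_kronecker_C_0_1) (auto simp: Delta_mat_def Lambda_mat_def mat1_def)

subsection \<open>Complex matrices as real matrices\<close>

definition realify :: "complex mat \<Rightarrow> real mat" where
  "realify A = mat (2 * dim_row A) (2 * dim_col A) (\<lambda>(i, j).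
     C_mat (Re (A $$ (i div 2, j div 2))) (Im (A $$ (i div 2, j div 2))) $$ (i mod 2, j mod 2))"

lemma realify_carrier: "A \<in> carrier_mat n m \<Longrightarrow> realify A \<in> carrier_mat (2 * n) (2 * m)"
  by (auto simp: realify_def)

lemma realify_dim [simp]: "dim_row (realify A) = 2 * dim_row A" "dim_col (realify A) = 2 * dim_col A"
  by (simp_all add: realify_def)

lemma realify_index:
  assumes "a < dim_row A" "b < dim_col A"
  shows "realify A $$ (2 * a, 2 * b) = Re (A $$ (a, b))"
    "realify A $$ (2 * a, Suc (2 * b)) = Im (A $$ (a, b))"
    "realify A $$ (Suc (2 * a), 2 * b) = - Im (A $$ (a, b))"
    "realify A $$ (Suc (2 * a), Suc (2 * b)) = Re (A $$ (a, b))"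
  using assms by (auto simp: realify_def C_mat_def)

lemma realify_eqI:
  assumes A: "A \<in> carrier_mat n m" and M: "M \<in> carrier_mat (2 * n) (2 * m)"
    and "\<And>a b. a < n \<Longrightarrow> b < m \<Longrightarrow> M $$ (2 * a, 2 * b) = Re (A $$ (a, b))"
    and "\<And>a b. a < n \<Longrightarrow> b < m \<Longrightarrow> M $$ (2 * a, Suc (2 * b)) = Im (A $$ (a, b))"
    and "\<And>a b. a < n \<Longrightarrow> b < m \<Longrightarrow> M $$ (Suc (2 * a), 2 * b) = - Im (A $$ (a, b))"
    and "\<And>a b. a < n \<Longrightarrow> b < m \<Longrightarrow> M $$ (Suc (2 * a), Suc (2 * b)) = Re (A $$ (a, b))"
  shows "M = realify A"
proof (rule eq_matI)
  fix i j assume "i < dim_row (realify A)" "j < dim_col (realify A)"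
  then have "i < 2 * n" "j < 2 * m" using A by auto
  moreover define a b where "a = i div 2" and "b = j div 2"
  ultimately have "a < n" "i = 2 * a \<or> i = Suc (2 * a)" "b < m" "j = 2 * b \<or> j = Suc (2 * b)"
    by auto
  then show "M $$ (i, j) = realify A $$ (i, j)"
    using assms by (auto simp: realify_index)
qed (use A M in auto)

lemma sum_lessThan_double: "(\<Sum>l<2 * n. g l) = (\<Sum>l<n. g (2 * l) + g (Suc (2 * l)))"
  for g :: "nat \<Rightarrow> 'a::comm_monoid_add"
  by (induction n) (auto simp: add.assoc)

lemma realify_mult:
  assumes A: "A \<in> carrier_mat n m" and B: "B \<in> carrier_mat m p"
  shows "realify A * realify B = realify (A * B)"
proof (rule realify_eqI)
  note idx = index_mult_mat_sum[OF realify_carrier[OF A] realify_carrier[OF B]]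
    index_mult_mat_sum[OF A B] sum_lessThan_double realify_index
  fix a b assume ab: "a < n" "b < p"
  show "(realify A * realify B) $$ (2 * a, 2 * b) = Re ((A * B) $$ (a, b))"
    "(realify A * realify B) $$ (2 * a, Suc (2 * b)) = Im ((A * B) $$ (a, b))"
    "(realify A * realify B) $$ (Suc (2 * a), 2 * b) = - Im ((A * B) $$ (a, b))"
    "(realify A * realify B) $$ (Suc (2 * a), Suc (2 * b)) = Re ((A * B) $$ (a, b))"
    using ab carrier_matD[OF A] carrier_matD[OF B]
    by (simp_all add: idx del: index_mult_mat(1) mult_Suc_right)
       (simp_all add: algebra_simps sum.distrib sum_subtractf sum_negf)
qed (use A B realify_carrier[OF A] realify_carrier[OF B] in auto)

lemma realify_one: "realify (1\<^sub>m n) = 1\<^sub>m (2 * n)"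
  by (rule realify_eqI[symmetric, of _ n n]) (auto simp: double_not_eq_Suc_double Suc_double_not_eq_double)

lemma realify_adjoint: "transpose_mat (realify A) = realify (map_mat cnj (transpose_mat A))"
  by (rule realify_eqI[of _ "dim_col A" "dim_row A"]) (auto simp: realify_index)

lemma realify_smult: "of_real c \<cdot>\<^sub>m A = B \<Longrightarrow> c \<cdot>\<^sub>m realify A = realify B"
  by (rule realify_eqI[of _ "dim_row A" "dim_col A"]) (auto simp: realify_index)

lemma realify_jordan_block: "realify (jordan_block k \<mu>) = C_blocks k (Re \<mu>) (Im \<mu>)"
  unfolding C_blocks_def block_mat1_def
  by (rule realify_eqI[symmetric, of _ k k]) (auto simp: jordan_block_def C_mat_def)

text \<open>Since \<open>realify\<close> is multiplicative and sends adjoints to transposes, a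
  complex congruence that uses the adjoint becomes a real congruence.\<close>

lemma real_congruent_realify:
  assumes A: "A \<in> carrier_mat n n" and S: "S \<in> carrier_mat n n" "invertible_mat S"
  shows "real_congruent (realify A) (realify (S * A * map_mat cnj (transpose_mat S)))"
proof (rule real_congruentI)
  obtain S' where S': "S' \<in> carrier_mat n n" "S * S' = 1\<^sub>m n" using invertible_matE[OF S(2,1)] .
  show "realify A \<in> carrier_mat (2 * n) (2 * n)" "realify S \<in> carrier_mat (2 * n) (2 * n)"
    using A S by (auto intro: realify_carrier)
  show "invertible_mat (realify S)"
    using S S' by (intro invertible_matI[of _ "2 * n" "realify S'"])
      (auto intro: realify_carrier simp: realify_mult[of _ n n] realify_one)
  show "realify S * realify A * transpose_mat (realify S) = realify (S * A * map_mat cnj (transpose_mat S))"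
    using A S by (simp add: realify_adjoint realify_mult[of _ n n _ n] mult_carrier_mat[of _ n n])
qed

text \<open>This is complex conjugation as a real linear map, in interleaved real and imaginary
  coordinates. Conjugating \<open>realify A\<close> by it replaces \<open>A\<close> by its entrywise
  complex conjugate.\<close>

definition conj_mat :: "nat \<Rightarrow> real mat" where
  "conj_mat n = mat (2 * n) (2 * n) (\<lambda>(i, j). if i = j then (-1) ^ i else 0)"

lemma conj_mat_carrier [simp]: "conj_mat n \<in> carrier_mat (2 * n) (2 * n)"
  by (simp add: conj_mat_def)

lemma transpose_conj_mat [simp]: "transpose_mat (conj_mat n) = conj_mat n"
  by (rule eq_matI) (auto simp: conj_mat_def)

lemma mult_conj_mat_index:
  assumes "M \<in> carrier_mat m (2 * n)" "i < m" "j < 2 * n"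
  shows "(M * conj_mat n) $$ (i, j) = (-1) ^ j * M $$ (i, j)"
proof -
  have "(M * conj_mat n) $$ (i, j) = (\<Sum>l<2 * n. M $$ (i, l) * conj_mat n $$ (l, j))"
    using assms by (intro index_mult_mat_sum) auto
  also have "\<dots> = (\<Sum>l<2 * n. if l = j then (-1) ^ j * M $$ (i, j) else 0)"
    using assms by (intro sum.cong) (auto simp: conj_mat_def)
  finally show ?thesis using assms by simp
qed

lemma conj_mat_mult_index:
  assumes "M \<in> carrier_mat (2 * n) m" "i < 2 * n" "j < m"
  shows "(conj_mat n * M) $$ (i, j) = (-1) ^ i * M $$ (i, j)"
proof -
  have "conj_mat n * M = transpose_mat (transpose_mat M * conj_mat n)"
    using assms by (simp add: transpose_mult[of _ m "2 * n" _ "2 * n"])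
  moreover have "(transpose_mat M * conj_mat n) $$ (j, i) = (-1) ^ i * M $$ (i, j)"
    using assms by (subst mult_conj_mat_index[of _ m]) auto
  ultimately show ?thesis
    using assms carrier_matD[OF conj_mat_carrier[of n]] by (simp del: index_mult_mat(1))
qed

lemma conj_mat_square: "conj_mat n * conj_mat n = 1\<^sub>m (2 * n)"
  by (rule eq_matI) (auto simp: mult_conj_mat_index[of _ "2 * n"] simp del: index_mult_mat(1),
      auto simp: conj_mat_def simp flip: power_add)

lemma invertible_conj_mat: "invertible_mat (conj_mat n)"
  using conj_mat_square by (intro invertible_matI[of _ "2 * n" "conj_mat n"]) auto

lemma realify_conj:
  assumes "A \<in> carrier_mat n n"
  shows "conj_mat n * realify A * conj_mat n = realify (map_mat cnj A)"
proof (rule realify_eqI)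
  note A = realify_carrier[OF assms]
  note idx = mult_conj_mat_index[of "conj_mat n * realify A" "2 * n"] conj_mat_mult_index[OF A]
    realify_index
  fix a b assume ab: "a < n" "b < n"
  show "(conj_mat n * realify A * conj_mat n) $$ (2 * a, 2 * b) = Re (map_mat cnj A $$ (a, b))"
    "(conj_mat n * realify A * conj_mat n) $$ (2 * a, Suc (2 * b)) = Im (map_mat cnj A $$ (a, b))"
    "(conj_mat n * realify A * conj_mat n) $$ (Suc (2 * a), 2 * b) = - Im (map_mat cnj A $$ (a, b))"
    "(conj_mat n * realify A * conj_mat n) $$ (Suc (2 * a), Suc (2 * b)) = Re (map_mat cnj A $$ (a, b))"
    using ab assms mult_carrier_mat[OF conj_mat_carrier A]
    by (simp_all add: idx del: index_mult_mat(1))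
qed (use assms in \<open>auto simp: conj_mat_def\<close>)

lemma real_congruent_realify_cnj:
  assumes "A \<in> carrier_mat n n"
  shows "real_congruent (realify A) (realify (map_mat cnj A))"
  by (rule real_congruentI[OF realify_carrier[OF assms] conj_mat_carrier invertible_conj_mat])
     (simp add: realify_conj[OF assms])

section \<open>The block beta5\<close>

lemma real_congruent_H_hat_uminus: "real_congruent (H_hat k a b) (H_hat k a (- b))"
  unfolding H_hat_def
proof (rule real_congruent_four_block[of _ _ _ _ "conj_mat k" "conj_mat k"])
  have C: "C_blocks k a b = realify (jordan_block k (Complex a b))"
    "C_blocks k a (- b) = realify (map_mat cnj (jordan_block k (Complex a b)))"
    by (simp add: realify_jordan_block, subst realify_jordan_block[of k "Complex a (- b)", simplified, symmetric])
       (auto intro!: arg_cong[of _ _ realify] eq_matI simp: jordan_block_def complex_eq_iff)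
  show "conj_mat k * C_blocks k a b * transpose_mat (conj_mat k) = C_blocks k a (- b)"
    unfolding C transpose_conj_mat by (rule realify_conj) simp
  show "C_blocks k a b \<in> carrier_mat (2 * k) (2 * k)"
    by (simp add: C_blocks_def block_mat1_def)
qed (auto simp: invertible_conj_mat conj_mat_square right_mult_one_mat[of _ "2 * k" "2 * k"])

text \<open>The complex reduction uses plain transposes, whereas \<open>realify\<close> turns
  adjoints into transposes. The factors \<open>conj_mat k\<close> bridge the gap: they convert one
  into the other, and leave the conjugate of \<open>\<mu>\<close> in the final Jordan block, hence
  the sign of \<open>Im \<mu>\<close>.\<close>

lemma real_congruent_realify_pencil:
  fixes f g :: "complex fps"
  assumes "fps_nth f 0 \<noteq> 0" "fps_nth g 0 = \<mu> * fps_nth f 0" "fps_nth g 1 \<noteq> \<mu> * fps_nth f 1"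
  shows "real_congruent (four_block_mat (0\<^sub>m (2 * k) (2 * k)) (realify (hankel k f) * conj_mat k)
      (realify (hankel k g) * conj_mat k) (0\<^sub>m (2 * k) (2 * k))) (H_hat k (Re \<mu>) (- Im \<mu>))"
proof -
  let ?\<Sigma> = "conj_mat k" and ?F = "hankel k f" and ?G = "hankel k g"
  obtain P Q where PQ: "P \<in> carrier_mat k k" "Q \<in> carrier_mat k k" "invertible_mat P" "invertible_mat Q"
    "P * ?F * transpose_mat Q = 1\<^sub>m k" "Q * ?G * transpose_mat P = jordan_block k \<mu>"
    using exists_hankel_pencil_reduction[OF assms, of k] by metis
  have inv: "invertible_mat (realify M)" if M: "M \<in> carrier_mat k k" "invertible_mat M" for M
  proof -
    obtain M' where M': "M' \<in> carrier_mat k k" "M * M' = 1\<^sub>m k" using invertible_matE[OF M(2,1)] .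
    show ?thesis using M M' by (intro invertible_matI[of _ "2 * k" "realify M'"])
      (auto intro: realify_carrier simp: realify_mult[of _ k k] realify_one)
  qed
  have r: "realify M \<in> carrier_mat (2 * k) (2 * k)" if "M \<in> carrier_mat k k" for M
    using that by (rule realify_carrier)
  note assoc = assoc_mult_mat[of _ "2 * k" "2 * k" _ "2 * k" _ "2 * k"]
  note carr = PQ(1,2) r mult_carrier_mat[of _ "2 * k" "2 * k" _ "2 * k"] mult_carrier_mat[of _ k k _ k]
  have conj: "?\<Sigma> * (realify (map_mat cnj (transpose_mat M)) * ?\<Sigma>) = realify (transpose_mat M)"
    if "M \<in> carrier_mat k k" for M
  proof -
    have "map_mat cnj (map_mat cnj (transpose_mat M)) = transpose_mat M" by (rule eq_matI) auto
    then show ?thesis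
      using realify_conj[of "map_mat cnj (transpose_mat M)" k] that
      by (simp add: assoc carr)
  qed
  \<comment> \<open>With \<open>?\<Sigma> * realify Q\<close> in place of \<open>realify Q\<close>,
    the transposed factor and the given \<open>?\<Sigma>\<close> enclose an adjoint and make it a
    plain transpose.\<close>
  have "realify P * (realify ?F * ?\<Sigma>) * transpose_mat (?\<Sigma> * realify Q)
      = realify P * realify ?F * (?\<Sigma> * (realify (map_mat cnj (transpose_mat Q)) * ?\<Sigma>))"
    by (simp add: transpose_mult[of _ "2 * k" "2 * k" _ "2 * k"] carr realify_adjoint assoc)
  also have "\<dots> = realify (P * ?F * transpose_mat Q)"
    by (simp add: conj carr realify_mult[of _ k k _ k])
  finally have 1: "realify P * (realify ?F * ?\<Sigma>) * transpose_mat (?\<Sigma> * realify Q) = 1\<^sub>m (2 * k)"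
    by (simp add: PQ realify_one)
  have PT: "realify (map_mat cnj (transpose_mat P)) = ?\<Sigma> * (realify (transpose_mat P) * ?\<Sigma>)"
    using realify_conj[of "transpose_mat P" k] by (simp add: assoc carr)
  have cancel: "?\<Sigma> * (?\<Sigma> * M) = M" if "M \<in> carrier_mat (2 * k) (2 * k)" for M
    using that assoc[of ?\<Sigma> ?\<Sigma> M] by (simp add: conj_mat_square)
  have "?\<Sigma> * realify Q * (realify ?G * ?\<Sigma>) * transpose_mat (realify P)
      = ?\<Sigma> * (realify Q * (realify ?G * (realify (transpose_mat P) * ?\<Sigma>)))"
    unfolding realify_adjoint PT by (simp add: carr assoc cancel)
  also have "\<dots> = ?\<Sigma> * realify (Q * ?G * transpose_mat P) * ?\<Sigma>"
    by (simp add: carr assoc flip: realify_mult[of _ k k _ k])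
  also have "\<dots> = realify (map_mat cnj (jordan_block k \<mu>))"
    unfolding PQ by (rule realify_conj) simp
  also have "map_mat cnj (jordan_block k \<mu>) = jordan_block k (cnj \<mu>)"
    by (rule eq_matI) (auto simp: jordan_block_def)
  finally have 2: "?\<Sigma> * realify Q * (realify ?G * ?\<Sigma>) * transpose_mat (realify P)
    = C_blocks k (Re \<mu>) (- Im \<mu>)"
    by (simp add: realify_jordan_block)
  show ?thesis unfolding H_hat_def
    using PQ 1 2 by (intro real_congruent_four_block[of _ _ _ _ "realify P" "?\<Sigma> * realify Q"])
      (auto simp: carr inv invertible_conj_mat intro!: invertible_mat_mult[of _ "2 * k"])
qed

lemma anti_blocks_C_mat:
  "anti_blocks k (C_mat p q) (C_mat p' q')
    = realify (hankel k (fps_const (Complex p q) + fps_const (Complex p' q') * fps_X))"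
  unfolding anti_blocks_def block_mat1_def
  by (rule realify_eqI[of _ k k]) (auto simp: hankel_def C_mat_def)

text \<open>A symmetric traceless 2 x 2 block with first row p, q is C(p, -q) followed by the
  diagonal matrix with entries 1 and -1.\<close>

lemma anti_blocks_reflection:
  "anti_blocks k (mat_2x2 p q q (- p)) (mat_2x2 p' q' q' (- p'))
    = realify (hankel k (fps_const (Complex p (- q)) + fps_const (Complex p' (- q')) * fps_X)) * conj_mat k"
    (is "?A = ?B * _")
proof (rule eq_matI)
  have A: "anti_blocks k (C_mat p (- q)) (C_mat p' (- q')) = ?B"
    by (rule anti_blocks_C_mat)
  have B: "?B \<in> carrier_mat (2 * k) (2 * k)" by (rule realify_carrier) simp
  fix i j assume "i < dim_row (?B * conj_mat k)" "j < dim_col (?B * conj_mat k)"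
  then have ij: "i < 2 * k" "j < 2 * k" using B by (auto simp: conj_mat_def)
  define a b where "a = i div 2" and "b = j div 2"
  have "i = 2 * a \<or> i = Suc (2 * a)" "j = 2 * b \<or> j = Suc (2 * b)"
    unfolding a_def b_def by auto
  then have "?A $$ (i, j) = (-1) ^ j * anti_blocks k (C_mat p (- q)) (C_mat p' (- q')) $$ (i, j)"
    using ij by (elim disjE) (simp_all add: anti_blocks_def block_mat1_def C_mat_def)
  then show "?A $$ (i, j) = (?B * conj_mat k) $$ (i, j)"
    unfolding mult_conj_mat_index[OF B ij] A .
qed (auto simp: anti_blocks_def block_mat1_def conj_mat_def hankel_def)

lemma real_congruent_H_hat_abs:
  assumes "real_congruent A (H_hat k a b)"
  shows "real_congruent A (H_hat k a \<bar>b\<bar>)"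
  using assms real_congruent_trans[OF assms real_congruent_H_hat_uminus]
  by (cases "b \<ge> 0") auto

lemma real_congruent_lw_beta5:
  assumes a: "a \<noteq> 0" and b: "b \<noteq> 0"
  shows "real_congruent (lw_beta5 a b k)
    (H_hat k ((1 - (a\<^sup>2 + b\<^sup>2)) / ((1 + \<bar>a\<bar>)\<^sup>2 + b\<^sup>2)) (2 * \<bar>b\<bar> / ((1 + \<bar>a\<bar>)\<^sup>2 + b\<^sup>2)))"
proof -
  define f where "f = fps_const (Complex b (- (a + 1))) + fps_const (Complex 0 (- 1)) * fps_X"
  define g where "g = fps_const (Complex (- b) (a - 1)) + fps_const (Complex 0 1) * fps_X"
  let ?X = "realify (hankel k f) * conj_mat k" and ?Y = "realify (hankel k g) * conj_mat k"
  have T: "- mat_2x2 b (a - 1) (a - 1) (- b) = mat_2x2 (- b) (1 - a) (1 - a) (- (- b))"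
    "- mat_2x2 0 1 1 0 = mat_2x2 0 (- 1) (- 1) (- 0)"
    by (rule eq_matI, auto simp: mat_2x2_def mat_of_rows_list_def less_Suc_eq numeral_2_eq_2)+
  have "lw_beta5 a b k = four_block_mat (0\<^sub>m (2 * k) (2 * k)) ?X ?Y (0\<^sub>m (2 * k) (2 * k))"
    unfolding lw_beta5_def Let_def T f_def g_def
    using anti_blocks_reflection[of k b "a + 1" 0 1] anti_blocks_reflection[of k "- b" "1 - a" 0 "- 1"]
    by simp
  moreover have carr: "?X \<in> carrier_mat (2 * k) (2 * k)" "?Y \<in> carrier_mat (2 * k) (2 * k)"
    by (auto intro!: mult_carrier_mat[of _ "2 * k" "2 * k"] realify_carrier)
  moreover define N where "N = (1 + \<bar>a\<bar>)\<^sup>2 + b\<^sup>2"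
  moreover have N: "N > 0" using b by (auto simp: N_def intro: add_nonneg_pos)
  \<comment> \<open>If \<open>a > 0\<close>, then \<open>N\<close> is the squared modulus of the
    constant term of \<open>f\<close>, and \<open>\<mu>\<close> is the quotient of the constant
    terms of \<open>g\<close> and \<open>f\<close>. Its imaginary part is nonzero, so it is not -1
    and the first-order condition holds.\<close>
  moreover define \<mu> where "\<mu> = Complex ((1 - (a\<^sup>2 + b\<^sup>2)) / N) (- 2 * b / N)"
  moreover have "real_congruent (four_block_mat (0\<^sub>m (2 * k) (2 * k)) ?X ?Y (0\<^sub>m (2 * k) (2 * k)))
    (H_hat k (Re \<mu>) \<bar>2 * b / N\<bar>)"
  proof (cases "a > 0")
    case True
    have "fps_nth f 0 \<noteq> 0" using b by (simp add: f_def complex_eq_iff)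
    moreover have "fps_nth g 0 = \<mu> * fps_nth f 0"
      using N True by (simp add: f_def g_def \<mu>_def complex_eq_iff field_simps)
        (simp add: N_def power2_eq_square algebra_simps)
    moreover have "fps_nth g 1 \<noteq> \<mu> * fps_nth f 1"
      using N True b by (auto simp: f_def g_def \<mu>_def complex_eq_iff)
    ultimately show ?thesis
      using real_congruent_realify_pencil[of f g \<mu> k] by (intro real_congruent_H_hat_abs) (simp add: \<mu>_def)
  next
    case False
    \<comment> \<open>Now \<open>N\<close> is the squared modulus of the constant term of
      \<open>g\<close>, so \<open>f\<close> and \<open>g\<close> exchange roles and the quotient
      becomes \<open>cnj \<mu>\<close>.\<close>
    have "fps_nth g 0 \<noteq> 0" using b by (simp add: g_def complex_eq_iff)
    moreover have "fps_nth f 0 = cnj \<mu> * fps_nth g 0"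
      using N False by (simp add: f_def g_def \<mu>_def complex_eq_iff field_simps)
        (simp add: N_def power2_eq_square algebra_simps)
    moreover have "fps_nth f 1 \<noteq> cnj \<mu> * fps_nth g 1"
      using N False b by (auto simp: f_def g_def \<mu>_def complex_eq_iff)
    ultimately have "real_congruent (four_block_mat (0\<^sub>m (2 * k) (2 * k)) ?Y ?X (0\<^sub>m (2 * k) (2 * k)))
      (H_hat k (Re (cnj \<mu>)) (- Im (cnj \<mu>)))"
      by (rule real_congruent_realify_pencil)
    from real_congruent_H_hat_abs[OF real_congruent_trans[OF real_congruent_swap[OF carr] this]]
    show ?thesis by (simp add: \<mu>_def)
  qed
  ultimately show ?thesis by (simp add: abs_mult)
qed

section \<open>The block beta4\<close>

lemma Gamma_kronecker_C_mat:
  "Gamma_mat k \<otimes>\<^sub>K C_mat p q = realify (Complex p q \<cdot>\<^sub>m map_mat of_real (Gamma_mat k))"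
  unfolding kronecker_C_mat[OF Gamma_mat_carrier]
  by (rule realify_eqI[of _ k k]) (auto simp: C_mat_def Gamma_mat_def mat1_def)

lemma i_power_mult_cnj: "\<i> ^ Suc i * cnj (\<i> ^ Suc j) = \<i> ^ (i + j + 2) * (-1) ^ Suc j"
proof -
  have "cnj (\<i> ^ Suc j) = (-1) ^ Suc j * \<i> ^ Suc j"
    by (simp only: complex_cnj_power complex_cnj_i power_minus[of \<i>])
  moreover have "\<i> ^ (i + j + 2) = \<i> ^ Suc i * \<i> ^ Suc j"
    by (simp only: power_add power_Suc power2_eq_square mult_ac)
  ultimately show ?thesis by (simp only: mult_ac)
qed

text \<open>The congruence is by the unitary diagonal matrix with entries \<open>\<i>\<^bsup>r\<^esup>\<close>, \<open>1 \<le> r \<le> k\<close>.\<close>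
lemma real_congruent_realify_Gamma:
  "real_congruent (realify (hankel k (fps_const z + fps_const (\<i> * z) * fps_X)))
    (realify ((- (\<i> ^ (k + 1)) * z) \<cdot>\<^sub>m map_mat of_real (Gamma_mat k)))"
proof -
  define A where "A = hankel k (fps_const z + fps_const (\<i> * z) * fps_X)"
  define D where "D = mat k k (\<lambda>(i, j). if i = j then \<i> ^ Suc i else 0)"
  have A: "A \<in> carrier_mat k k" and D: "D \<in> carrier_mat k k" by (auto simp: A_def D_def)
  define D' where "D' = map_mat cnj (transpose_mat D)"
  have D': "D' \<in> carrier_mat k k" using D by (simp add: D'_def)
  have 1: "(D * M) $$ (i, j) = \<i> ^ Suc i * M $$ (i, j)" if "M \<in> carrier_mat k k" "i < k" "j < k" for M i j
  proof -
    have "(D * M) $$ (i, j) = (\<Sum>l<k. D $$ (i, l) * M $$ (l, j))"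
      using D that by (rule index_mult_mat_sum)
    also have "\<dots> = (\<Sum>l<k. if l = i then \<i> ^ Suc i * M $$ (i, j) else 0)"
      using that by (intro sum.cong) (auto simp: D_def)
    finally show ?thesis using that by simp
  qed
  have 2: "(M * D') $$ (i, j) = cnj (\<i> ^ Suc j) * M $$ (i, j)"
    if "M \<in> carrier_mat k k" "i < k" "j < k" for M i j
  proof -
    have "(M * D') $$ (i, j) = (\<Sum>l<k. M $$ (i, l) * D' $$ (l, j))"
      using that D' by (intro index_mult_mat_sum) auto
    also have "\<dots> = (\<Sum>l<k. if l = j then cnj (\<i> ^ Suc j) * M $$ (i, j) else 0)"
      using that by (intro sum.cong) (auto simp: D'_def D_def)
    finally show ?thesis using that by simp
  qed
  have "D * D' = 1\<^sub>m k"
  proof (rule eq_matI)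
    fix i j assume "i < dim_row (1\<^sub>m k :: complex mat)" "j < dim_col (1\<^sub>m k :: complex mat)"
    then have ij: "i < k" "j < k" by auto
    have "\<i> ^ Suc m * cnj (\<i> ^ Suc m) = 1" for m
      by (simp only: complex_norm_square[symmetric] norm_power norm_ii power_one of_real_1)
    then show "(D * D') $$ (i, j) = 1\<^sub>m k $$ (i, j)"
      unfolding 1[OF D' ij] using ij by (simp add: D'_def D_def del: power_Suc)
  qed (use D D' in auto)
  then have "invertible_mat D" using D D' by (intro invertible_matI)
  from real_congruent_realify[OF A D this]
  have "real_congruent (realify A) (realify (D * A * D'))" by (simp add: D'_def)
  moreover have "D * A * D' = (- (\<i> ^ (k + 1)) * z) \<cdot>\<^sub>m map_mat of_real (Gamma_mat k)"
  proof (rule eq_matI)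
    fix i j assume "i < dim_row ((- (\<i> ^ (k + 1)) * z) \<cdot>\<^sub>m map_mat of_real (Gamma_mat k))"
      "j < dim_col ((- (\<i> ^ (k + 1)) * z) \<cdot>\<^sub>m map_mat of_real (Gamma_mat k))"
    then have ij: "i < k" "j < k" by (auto simp: Gamma_mat_def mat1_def)
    have DA: "D * A \<in> carrier_mat k k" using D A by simp
    have "(D * A * D') $$ (i, j) = \<i> ^ Suc i * cnj (\<i> ^ Suc j) * A $$ (i, j)"
      unfolding 2[OF DA ij] 1[OF A ij] by (simp only: mult_ac)
    also have "\<dots> = \<i> ^ (i + j + 2) * (-1) ^ Suc j * A $$ (i, j)"
      by (simp only: i_power_mult_cnj)
    also have "\<dots> = (- (\<i> ^ (k + 1)) * z) * of_real (Gamma_mat k $$ (i, j))"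
    proof -
      \<comment> \<open>From the first antidiagonal to the second, the power of \<open>\<i>\<close>
        rises by one and the coefficient \<open>\<i> * z\<close> adds another factor
        \<open>\<i>\<close>. Their product -1 offsets the change in how the sign of
        \<open>Gamma_mat\<close> depends on \<open>j\<close>.\<close>
      consider "i + j + 1 = k" | "i + j = k" | "i + j + 1 \<noteq> k" "i + j \<noteq> k" by blast
      then show ?thesis
      proof cases
        case 1
        then have "i + j + 2 = k + 1" "k - 1 - i = j" by auto
        with 1 ij show ?thesis by (simp add: A_def hankel_def Gamma_mat_def mat1_def)
      next
        case 2
        then have "i + j + 2 = Suc (k + 1)" and j: "j = Suc (k - 1 - i)" using ij by auto
        moreover have "(- 1 :: complex) ^ j = - ((- 1) ^ (k - Suc i))" by (subst j) simp
        ultimately show ?thesis using 2 ij by (simp add: A_def hankel_def Gamma_mat_def mat1_def)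
      next
        case 3
        with ij show ?thesis by (auto simp: A_def hankel_def Gamma_mat_def mat1_def)
      qed
    qed
    finally show "(D * A * D') $$ (i, j) = ((- (\<i> ^ (k + 1)) * z) \<cdot>\<^sub>m map_mat of_real (Gamma_mat k)) $$ (i, j)"
      using ij by (simp add: Gamma_mat_def mat1_def)
  qed (use D D' A in \<open>auto simp: Gamma_mat_def mat1_def\<close>)
  ultimately show ?thesis by (simp add: A_def)
qed

text \<open>The real matrix that reduces both real forms at once is its own complex conjugate, so
  its adjoint is its transpose and it reduces every complex combination of the two forms.\<close>

lemma real_congruent_realify_real_pencil:
  fixes p q :: "real fps"
  assumes "fps_nth p 0 > 0" "fps_nth q 0 = 0" "fps_nth q 1 > 0"
  shows "real_congruent (realify (z \<cdot>\<^sub>m map_mat of_real (hankel k p) + z' \<cdot>\<^sub>m map_mat of_real (hankel k q)))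
    (realify (hankel k (fps_const z + fps_const z' * fps_X)))"
proof -
  obtain S where S: "S \<in> carrier_mat k k" "invertible_mat S"
    "S * hankel k p * transpose_mat S = hankel k 1" "S * hankel k q * transpose_mat S = hankel k fps_X"
    using exists_hankel_symmetric_pencil_reduction[OF assms] .
  obtain S' where S': "S' \<in> carrier_mat k k" "S * S' = 1\<^sub>m k" using invertible_matE[OF S(2,1)] .
  let ?c = "map_mat complex_of_real"
  let ?A = "z \<cdot>\<^sub>m ?c (hankel k p) + z' \<cdot>\<^sub>m ?c (hankel k q)"
  have "?c S * ?c S' = ?c (S * S')" by (rule of_real_hom.mat_hom_mult[OF S(1) S'(1), symmetric])
  then have "?c S * ?c S' = 1\<^sub>m k" by (simp add: S' of_real_hom.mat_hom_one)
  then have inv: "invertible_mat (?c S)" using S S' by (intro invertible_matI[of _ k "?c S'"]) auto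
  have cnj: "map_mat cnj (transpose_mat (?c S)) = ?c (transpose_mat S)"
    by (rule eq_matI) auto
  have hom: "?c S * ?c M * ?c (transpose_mat S) = ?c (S * M * transpose_mat S)"
    if "M \<in> carrier_mat k k" for M
    using that S(1) by (simp add: of_real_hom.mat_hom_mult[of _ k k _ k] mult_carrier_mat[of _ k k])
  have "?c S * ?A * ?c (transpose_mat S)
      = z \<cdot>\<^sub>m (?c S * ?c (hankel k p) * ?c (transpose_mat S))
        + z' \<cdot>\<^sub>m (?c S * ?c (hankel k q) * ?c (transpose_mat S))"
    using S(1) by (simp add: mult_add_distrib_mat[of _ k k _ k] add_mult_distrib_mat[of _ k k _ _ k]
        mult_smult_distrib[of _ k k _ k] mult_smult_assoc_mat[of _ k k _ k] mult_carrier_mat[of _ k k])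
  also have "\<dots> = hankel k (fps_const z + fps_const z' * fps_X)"
    unfolding hom[OF hankel_carrier] S by (rule eq_matI) (auto simp: hankel_def)
  finally show ?thesis
    using real_congruent_realify[of ?A k "?c S"] S(1) inv by (simp add: cnj)
qed

lemma real_congruent_lw_beta4:
  assumes \<epsilon>: "\<epsilon> \<in> {1, -1}"
  shows "even k \<Longrightarrow> \<exists>s. s \<in> {1, -1} \<and> real_congruent (lw_beta4 \<epsilon> b k)
      (Gamma_mat k \<otimes>\<^sub>K C_mat (s * (\<bar>b\<bar> / sqrt (1 + b\<^sup>2))) (1 / sqrt (1 + b\<^sup>2)))"
    and "odd k \<Longrightarrow> \<exists>s. s \<in> {1, -1} \<and> real_congruent (lw_beta4 \<epsilon> b k)
      (Gamma_mat k \<otimes>\<^sub>K C_mat (s * (1 / sqrt (1 + b\<^sup>2))) (\<bar>b\<bar> / sqrt (1 + b\<^sup>2)))"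
proof -
  define r where "r = sqrt (1 + b\<^sup>2)"
  have r: "r > 0" "r * r = 1 + b\<^sup>2" by (auto simp: r_def intro: add_pos_nonneg)
  \<comment> \<open>The symbol of the block is \<open>\<epsilon>\<close> times 1 + i|b| + i x.
    Dividing it by the unit number \<open>z\<close>, the normalised constant term, leaves
    \<open>p + \<i> * q\<close> with real series \<open>p\<close> and \<open>q\<close>, where
    \<open>p\<close> has positive constant term and \<open>q\<close> vanishes to first
    order.\<close>
  define z where "z = Complex (\<epsilon> / r) (\<epsilon> * \<bar>b\<bar> / r)"
  define p where "p = fps_const r + fps_const (\<bar>b\<bar> / r) * fps_X"
  define q where "q = fps_const (1 / r) * fps_X"
  let ?G = "map_mat complex_of_real (Gamma_mat k)"
  have "lw_beta4 \<epsilon> b k = \<epsilon> \<cdot>\<^sub>m anti_blocks k (C_mat 1 \<bar>b\<bar>) (C_mat 0 1)"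
    by (simp add: lw_beta4_def C_mat_def)
  also have "\<dots> = realify (z \<cdot>\<^sub>m map_mat of_real (hankel k p) + (\<i> * z) \<cdot>\<^sub>m map_mat of_real (hankel k q))"
    unfolding anti_blocks_C_mat
    by (intro realify_smult eq_matI)
      (use r in \<open>auto simp: hankel_def p_def q_def z_def complex_eq_iff field_simps power2_eq_square\<close>)
  finally have "real_congruent (lw_beta4 \<epsilon> b k) (realify (hankel k (fps_const z + fps_const (\<i> * z) * fps_X)))"
    using real_congruent_realify_real_pencil[of p q z k "\<i> * z"] r by (simp add: p_def q_def)
  then have 1: "real_congruent (lw_beta4 \<epsilon> b k) (realify ((- (\<i> ^ (k + 1)) * z) \<cdot>\<^sub>m ?G))"
    using real_congruent_realify_Gamma real_congruent_trans by blast
  \<comment> \<open>Conjugation makes the sign of the imaginary part a free choice, so it can be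
    taken nonnegative as in the target. The sign of the real part remains and becomes
    \<open>s\<close>.\<close>
  have "map_mat cnj ((- (\<i> ^ (k + 1)) * z) \<cdot>\<^sub>m ?G) = cnj (- (\<i> ^ (k + 1)) * z) \<cdot>\<^sub>m ?G"
    by (rule eq_matI) auto
  then have 2: "real_congruent (lw_beta4 \<epsilon> b k) (realify (cnj (- (\<i> ^ (k + 1)) * z) \<cdot>\<^sub>m ?G))"
    using real_congruent_trans[OF 1 real_congruent_realify_cnj[of _ k]] by simp
  have *: "real_congruent (lw_beta4 \<epsilon> b k) (Gamma_mat k \<otimes>\<^sub>K C_mat x y)"
    if "Complex x y \<in> {- (\<i> ^ (k + 1)) * z, cnj (- (\<i> ^ (k + 1)) * z)}" for x y
    using that 1 2 unfolding Gamma_kronecker_C_mat by auto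
  have sign: "(- 1 :: complex) ^ l * of_real \<epsilon> = 1 \<or> (- 1 :: complex) ^ l * of_real \<epsilon> = - 1" for l
    using \<epsilon> by (auto simp: minus_one_power_iff)
  have z: "z = of_real \<epsilon> * Complex (1 / r) (\<bar>b\<bar> / r)" by (simp add: z_def complex_eq_iff)
  show "\<exists>s. s \<in> {1, -1} \<and> real_congruent (lw_beta4 \<epsilon> b k)
      (Gamma_mat k \<otimes>\<^sub>K C_mat (s * (\<bar>b\<bar> / sqrt (1 + b\<^sup>2))) (1 / sqrt (1 + b\<^sup>2)))" if k: "even k"
  proof -
    obtain l where "k = 2 * l" using k by (rule evenE)
    \<comment> \<open>For even \<open>k\<close> the factor is \<open>\<i>\<close> up to sign, which
      exchanges the real and imaginary parts of \<open>z\<close> up to sign; for odd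
      \<open>k\<close> it is a mere sign.\<close>
    then have "- (\<i> ^ (k + 1)) * z = ((- 1) ^ l * of_real \<epsilon>) * (- \<i> * Complex (1 / r) (\<bar>b\<bar> / r))"
      by (simp add: z power_mult)
    then consider "- (\<i> ^ (k + 1)) * z = - \<i> * Complex (1 / r) (\<bar>b\<bar> / r)"
      | "- (\<i> ^ (k + 1)) * z = \<i> * Complex (1 / r) (\<bar>b\<bar> / r)"
      using sign[of l] by fastforce
    then show ?thesis
    proof cases
      case 1
      show ?thesis
        by (rule exI[of _ 1], unfold r_def[symmetric], intro conjI *, simp)
           (unfold 1, simp add: complex_eq_iff)
    next
      case 2
      show ?thesis
        by (rule exI[of _ "- 1"], unfold r_def[symmetric], intro conjI *, simp)
           (unfold 2, simp add: complex_eq_iff)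
    qed
  qed
  show "\<exists>s. s \<in> {1, -1} \<and> real_congruent (lw_beta4 \<epsilon> b k)
      (Gamma_mat k \<otimes>\<^sub>K C_mat (s * (1 / sqrt (1 + b\<^sup>2))) (\<bar>b\<bar> / sqrt (1 + b\<^sup>2)))" if k: "odd k"
  proof -
    obtain l where "k = 2 * l + 1" using k by (rule oddE)
    then have "- (\<i> ^ (k + 1)) * z = ((- 1) ^ l * of_real \<epsilon>) * Complex (1 / r) (\<bar>b\<bar> / r)"
      by (simp add: z power_mult)
    then consider "- (\<i> ^ (k + 1)) * z = Complex (1 / r) (\<bar>b\<bar> / r)"
      | "- (\<i> ^ (k + 1)) * z = - Complex (1 / r) (\<bar>b\<bar> / r)"
      using sign[of l] by fastforce
    then show ?thesis
    proof cases
      case 1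
      show ?thesis
        by (rule exI[of _ 1], unfold r_def[symmetric], intro conjI *, simp)
           (unfold 1, simp add: complex_eq_iff)
    next
      case 2
      show ?thesis
        by (rule exI[of _ "- 1"], unfold r_def[symmetric], intro conjI *, simp)
           (unfold 2, simp add: complex_eq_iff)
    qed
  qed
qed

theorem theorem7p3:
  shows
   "(\<forall>k::nat. real_congruent (lw_m3 k) (jordan_block (2 * k + 1) 0)) \<and>
    (\<forall>(k::nat) (\<epsilon>::real). k \<ge> 1 \<longrightarrow> even k \<longrightarrow> \<epsilon> \<in> {1, -1} \<longrightarrow>
       real_congruent (lw_inf4 \<epsilon> k) (Gamma_mat k \<otimes>\<^sub>K mat_1x1 (\<epsilon> * (-1) ^ (k div 2 + 1)))) \<and>
    (\<forall>k::nat. k \<ge> 1 \<longrightarrow> odd k \<longrightarrow>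
       real_congruent (lw_inf5 k) (Gamma_mat k \<otimes>\<^sub>K C_mat 0 1)) \<and>
    (\<forall>(k::nat) (\<epsilon>::real). k \<ge> 1 \<longrightarrow> odd k \<longrightarrow> \<epsilon> \<in> {1, -1} \<longrightarrow>
       real_congruent (lw_o3 \<epsilon> k) (Gamma_mat k \<otimes>\<^sub>K mat_1x1 (\<epsilon> * (-1) ^ ((k - 1) div 2)))) \<and>
    (\<forall>k::nat. k \<ge> 1 \<longrightarrow> even k \<longrightarrow>
       real_congruent (lw_o4 k) (Gamma_mat k \<otimes>\<^sub>K C_mat 0 1)) \<and>
    (\<forall>(k::nat) (\<alpha>::real). k \<ge> 1 \<longrightarrow> \<alpha> > 0 \<longrightarrow>
       (\<alpha> = 1 \<longrightarrow> real_congruent (lw_alpha3 \<alpha> k) (jordan_block (2 * k) 0)) \<and>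
       (\<alpha> \<noteq> 1 \<longrightarrow> real_congruent (lw_alpha3 \<alpha> k) (H_mat k ((1 - \<alpha>) / (1 + \<alpha>))))) \<and>
    (\<forall>(k::nat) (\<epsilon>::real) (b::real). k \<ge> 1 \<longrightarrow> \<epsilon> \<in> {1, -1} \<longrightarrow> b \<noteq> 0 \<longrightarrow>
       (even k \<longrightarrow> (\<exists>s::real. s \<in> {1, -1} \<and> real_congruent (lw_beta4 \<epsilon> b k)
          (Gamma_mat k \<otimes>\<^sub>K C_mat (s * (\<bar>b\<bar> / sqrt (1 + b\<^sup>2))) (1 / sqrt (1 + b\<^sup>2))))) \<and>
       (odd k \<longrightarrow> (\<exists>s::real. s \<in> {1, -1} \<and> real_congruent (lw_beta4 \<epsilon> b k)
          (Gamma_mat k \<otimes>\<^sub>K C_mat (s * (1 / sqrt (1 + b\<^sup>2))) (\<bar>b\<bar> / sqrt (1 + b\<^sup>2)))))) \<and>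
    (\<forall>(k::nat) (a::real) (b::real). k \<ge> 1 \<longrightarrow> a \<noteq> 0 \<longrightarrow> b \<noteq> 0 \<longrightarrow>
       real_congruent (lw_beta5 a b k)
         (H_hat k ((1 - (a\<^sup>2 + b\<^sup>2)) / ((1 + \<bar>a\<bar>)\<^sup>2 + b\<^sup>2))
                  (2 * \<bar>b\<bar> / ((1 + \<bar>a\<bar>)\<^sup>2 + b\<^sup>2))))"
proof (intro conjI allI impI)
  fix k :: nat and \<alpha> :: real
  assume "\<alpha> > 0" "\<alpha> = 1"
  then show "real_congruent (lw_alpha3 \<alpha> k) (jordan_block (2 * k) 0)"
    using real_congruent_trans[OF real_congruent_lw_alpha3[of \<alpha> k]] real_congruent_H_mat_0[of k] by simp
qed (rule real_congruent_lw_m3 real_congruent_lw_inf4 real_congruent_lw_inf5 real_congruent_lw_o3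
    real_congruent_lw_o4 real_congruent_lw_alpha3 real_congruent_lw_beta4 real_congruent_lw_beta5; assumption)+

end
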